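(* Let $(Q_0,\xi_0)$ and $(Q_1,\xi_1)$ be contact manifolds (not necessarily coorientable). Let $\pi:SQ_0\times SQ_1\to Q_0\star Q_1$ be the quotient map and let $\widetilde\pi_i:SQ_0\times SQ_1\to Q_i$ be the composition of the projection to $SQ_i$ with the bundle projection $SQ_i\to Q_i$, for $i=0,1$. Then there exist canonical projections $p_i:Q_0\star Q_1\to Q_i$, $i=0,1$, such that $p_i\circ\pi=\widetilde\pi_i$.
   Context: A contact manifold $(Q,\xi)$ is a smooth manifold with a maximally non-integrable hyperplane distribution $\xi\subset TQ$. Its canonical symplectization is $SQ=\{\beta\in T^*Q\setminus\{0\}\mid \beta|_\xi=0\}$, with one-form $\theta$ the restriction of the Liouville one-form of $T^*Q$. The contact product is $Q_0\star Q_1=(SQ_0\times SQ_1)/\mathbb{R}_+$, the quotient by the diagonal action $r\cdot(\beta_0,\beta_1)=(r\beta_0,r\beta_1)$, $r>0$ (the flow of the sum of the Liouville/Euler vector fields), with contact structure the projection of $\ker(\theta_0\oplus\theta_1)$. *)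

theory Defs
  imports "HOL-Analysis.Analysis"
begin

text \<open>Both notions are meant for open \<open>S\<close>; continuity of the derivatives of order \<open>k\<close> is
  expressed through all iterated directional derivatives.\<close>

primrec ck_on :: "nat \<Rightarrow> 'e::euclidean_space set \<Rightarrow> ('e \<Rightarrow> 'f::euclidean_space) \<Rightarrow> bool" where
  "ck_on 0 S f \<longleftrightarrow> continuous_on S f"
| "ck_on (Suc k) S f \<longleftrightarrow> (\<forall>x\<in>S. f differentiable (at x)) \<and>
     (\<forall>v. ck_on k S (\<lambda>x. frechet_derivative f (at x) v))"

definition smooth_on :: "'e::euclidean_space set \<Rightarrow> ('e \<Rightarrow> 'f::euclidean_space) \<Rightarrow> bool" where
  "smooth_on S f \<longleftrightarrow> (\<forall>k. ck_on k S f)"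

text \<open>A chart is a pair of its domain and a coordinate map, whose values outside the domain are
  irrelevant. The dimension of a manifold is the dimension of the model space \<open>'e\<close>.\<close>

type_synonym ('a, 'e) chart = "'a set \<times> ('a \<Rightarrow> 'e)"

record ('a, 'e) manifold_data =
  points :: "'a set"
  charts :: "('a, 'e) chart set"

definition charts_at :: "('a, 'e, 'm) manifold_data_scheme \<Rightarrow> 'a \<Rightarrow> ('a, 'e) chart set" where
  "charts_at M p = {c \<in> charts M. p \<in> fst c}"

definition chart_inv :: "('a, 'e) chart \<Rightarrow> 'e \<Rightarrow> 'a" where
  "chart_inv c = inv_into (fst c) (snd c)"

text \<open>The topology of a manifold is the one determined by its atlas.\<close>

definition mtop :: "('a, 'e::euclidean_space, 'm) manifold_data_scheme \<Rightarrow> 'a topology" where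
  "mtop M = topology (\<lambda>W. W \<subseteq> points M \<and> (\<forall>c\<in>charts M. open (snd c ` (W \<inter> fst c))))"

lemma openin_mtop:
  assumes "\<And>c. c \<in> charts M \<Longrightarrow> inj_on (snd c) (fst c)"
  shows "openin (mtop M) W \<longleftrightarrow> W \<subseteq> points M \<and> (\<forall>c\<in>charts M. open (snd c ` (W \<inter> fst c)))"
proof -
  have "istopology (\<lambda>W. W \<subseteq> points M \<and> (\<forall>c\<in>charts M. open (snd c ` (W \<inter> fst c))))"
    unfolding istopology_def
  proof (intro conjI allI impI ballI)
    fix S T c
    assume S: "S \<subseteq> points M \<and> (\<forall>c\<in>charts M. open (snd c ` (S \<inter> fst c)))"
      and T: "T \<subseteq> points M \<and> (\<forall>c\<in>charts M. open (snd c ` (T \<inter> fst c)))"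
      and c: "c \<in> charts M"
    have "snd c ` (S \<inter> T \<inter> fst c) = snd c ` ((S \<inter> fst c) \<inter> (T \<inter> fst c))"
      by (rule arg_cong[where f="image (snd c)"]) auto
    also have "\<dots> = snd c ` (S \<inter> fst c) \<inter> snd c ` (T \<inter> fst c)"
      by (rule inj_on_image_Int[OF assms[OF c]]) auto
    finally show "open (snd c ` (S \<inter> T \<inter> fst c))" using S T c by auto
  next
    fix K c
    assume K: "\<forall>S\<in>K. S \<subseteq> points M \<and> (\<forall>c\<in>charts M. open (snd c ` (S \<inter> fst c)))"
      and c: "c \<in> charts M"
    have "snd c ` (\<Union>K \<inter> fst c) = (\<Union>S\<in>K. snd c ` (S \<inter> fst c))" by auto
    then show "open (snd c ` (\<Union>K \<inter> fst c))" using K c by auto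
  qed auto
  then show ?thesis unfolding mtop_def by (simp add: topology_inverse')
qed

definition smooth_manifold :: "('a, 'e::euclidean_space, 'm) manifold_data_scheme \<Rightarrow> bool" where
  "smooth_manifold M \<longleftrightarrow>
     (\<Union>c\<in>charts M. fst c) = points M \<and>
     (\<forall>c\<in>charts M. inj_on (snd c) (fst c) \<and> open (snd c ` fst c)) \<and>
     (\<forall>c\<in>charts M. \<forall>d\<in>charts M. open (snd c ` (fst c \<inter> fst d)) \<and>
        smooth_on (snd c ` (fst c \<inter> fst d)) (snd d \<circ> chart_inv c)) \<and>
     Hausdorff_space (mtop M) \<and> second_countable (mtop M)"

definition open_region :: "'e set \<Rightarrow> ('e, 'e) manifold_data" where
  "open_region S = \<lparr>points = S, charts = {(S, id)}\<rparr>"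

text \<open>\<open>f\<close> is smooth near \<open>p\<close> and its Jacobian at \<open>p\<close> satisfies \<open>P\<close>, in suitable charts.\<close>

definition smooth_at_with ::
  "(('e \<Rightarrow> 'f) \<Rightarrow> bool) \<Rightarrow> ('a, 'e::euclidean_space, 'm) manifold_data_scheme \<Rightarrow>
   ('b, 'f::euclidean_space, 'n) manifold_data_scheme \<Rightarrow> ('a \<Rightarrow> 'b) \<Rightarrow> 'a \<Rightarrow> bool" where
  "smooth_at_with P M N f p \<longleftrightarrow>
     (\<exists>c\<in>charts_at M p. \<exists>d\<in>charts_at N (f p). \<exists>W.
        openin (mtop M) W \<and> p \<in> W \<and> W \<subseteq> fst c \<and> f ` W \<subseteq> fst d \<and>
        smooth_on (snd c ` W) (snd d \<circ> f \<circ> chart_inv c) \<and>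
        P (frechet_derivative (snd d \<circ> f \<circ> chart_inv c) (at (snd c p))))"

abbreviation "immersive_at \<equiv> smooth_at_with inj"
abbreviation "submersive_at \<equiv> smooth_at_with surj"

definition smooth_submersion ::
  "('a, 'e::euclidean_space, 'm) manifold_data_scheme \<Rightarrow>
   ('b, 'f::euclidean_space, 'n) manifold_data_scheme \<Rightarrow> ('a \<Rightarrow> 'b) \<Rightarrow> bool" where
  "smooth_submersion M N f \<longleftrightarrow> (\<forall>p\<in>points M. f p \<in> points N \<and> submersive_at M N f p)"

text \<open>A tangent vector at \<open>p\<close> is the family of its components in all charts around \<open>p\<close>, related by
  the Jacobians of the coordinate changes; it is \<open>0\<close> at all other arguments.\<close>

type_synonym ('a, 'e) tangent = "('a, 'e) chart \<Rightarrow> 'e"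

definition tangent_space ::
  "('a, 'e::euclidean_space, 'm) manifold_data_scheme \<Rightarrow> 'a \<Rightarrow> ('a, 'e) tangent set" where
  "tangent_space M p = {v. (\<forall>c. c \<notin> charts_at M p \<longrightarrow> v c = 0) \<and>
     (\<forall>c\<in>charts_at M p. \<forall>d\<in>charts_at M p.
        v d = frechet_derivative (snd d \<circ> chart_inv c) (at (snd c p)) (v c))}"

definition coordinate_vector ::
  "('a, 'e::euclidean_space, 'm) manifold_data_scheme \<Rightarrow> 'a \<Rightarrow> ('a, 'e) chart \<Rightarrow> 'e
   \<Rightarrow> ('a, 'e) tangent" where
  "coordinate_vector M p c e = (\<lambda>d. if d \<in> charts_at M p
     then frechet_derivative (snd d \<circ> chart_inv c) (at (snd c p)) e else 0)"

text \<open>The differential of a map that is smooth at \<open>p\<close>; the result does not depend on the choice of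
  the chart of \<open>M\<close>.\<close>

definition differential ::
  "('a, 'e::euclidean_space, 'm) manifold_data_scheme \<Rightarrow>
   ('b, 'f::euclidean_space, 'n) manifold_data_scheme \<Rightarrow> ('a \<Rightarrow> 'b) \<Rightarrow> 'a
   \<Rightarrow> ('a, 'e) tangent \<Rightarrow> ('b, 'f) tangent" where
  "differential M N f p v =
     (let c = (SOME c. c \<in> charts_at M p) in
      (\<lambda>d. if d \<in> charts_at N (f p)
           then frechet_derivative (snd d \<circ> f \<circ> chart_inv c) (at (snd c p)) (v c) else 0))"

text \<open>Covectors at \<open>p\<close> are linear functionals on the tangent space, extended by \<open>0\<close>; a point of
  \<open>T\<^sup>*M\<close> is a covector together with its base point.\<close>

type_synonym ('a, 'e) covector = "'a \<times> (('a, 'e) tangent \<Rightarrow> real)"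

definition cotangent_space ::
  "('a, 'e::euclidean_space, 'm) manifold_data_scheme \<Rightarrow> 'a
   \<Rightarrow> (('a, 'e) tangent \<Rightarrow> real) set" where
  "cotangent_space M p = {\<beta>. (\<forall>v. v \<notin> tangent_space M p \<longrightarrow> \<beta> v = 0) \<and>
     (\<forall>v\<in>tangent_space M p. \<forall>w\<in>tangent_space M p. \<forall>s t.
        \<beta> (\<lambda>c. s *\<^sub>R v c + t *\<^sub>R w c) = s * \<beta> v + t * \<beta> w)}"

text \<open>The induced charts \<open>(p, \<beta>) \<mapsto> (x, y)\<close> of \<open>T\<^sup>*M\<close>, where \<open>x\<close> are the coordinates of \<open>p\<close> and \<open>y\<close> are
  the coefficients of \<open>\<beta>\<close>, regarded as a vector via the inner product of the model space.\<close>

definition cotangent_chart ::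
  "('a, 'e::euclidean_space, 'm) manifold_data_scheme \<Rightarrow> ('a, 'e) chart
   \<Rightarrow> (('a, 'e) covector, 'e \<times> 'e) chart" where
  "cotangent_chart M c =
     ({(p, \<beta>). p \<in> fst c \<and> \<beta> \<in> cotangent_space M p},
      \<lambda>(p, \<beta>). (snd c p, \<Sum>b\<in>Basis. \<beta> (coordinate_vector M p c b) *\<^sub>R b))"

definition cotangent_bundle ::
  "('a, 'e::euclidean_space, 'm) manifold_data_scheme
   \<Rightarrow> (('a, 'e) covector, 'e \<times> 'e) manifold_data" where
  "cotangent_bundle M =
     \<lparr>points = {(p, \<beta>). p \<in> points M \<and> \<beta> \<in> cotangent_space M p},
      charts = cotangent_chart M ` charts M\<rparr>"

definition product_manifold ::
  "('a, 'e, 'm) manifold_data_scheme \<Rightarrow> ('b, 'f, 'n) manifold_data_scheme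
   \<Rightarrow> ('a \<times> 'b, 'e \<times> 'f) manifold_data" where
  "product_manifold M N =
     \<lparr>points = points M \<times> points N,
      charts = {(fst c \<times> fst d, map_prod (snd c) (snd d)) | c d. c \<in> charts M \<and> d \<in> charts N}\<rparr>"

text \<open>The structure on \<open>S\<close> as an embedded submanifold of \<open>M\<close>: the charts are the inverses of the
  local parametrizations of \<open>S\<close>, i.e. of the immersions into \<open>M\<close> that are homeomorphisms onto a
  relatively open subset of \<open>S\<close>. The dimension of \<open>S\<close> is prescribed by the model space \<open>'f\<close>.\<close>

definition embedded_submanifold ::
  "('a, 'e::euclidean_space, 'm) manifold_data_scheme \<Rightarrow> 'a set
   \<Rightarrow> ('a, 'f::euclidean_space) manifold_data" where
  "embedded_submanifold M S =
     \<lparr>points = S,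
      charts = {c. openin (subtopology (mtop M) S) (fst c) \<and> open (snd c ` fst c) \<and>
        homeomorphic_map (subtopology (mtop M) (fst c)) (top_of_set (snd c ` fst c)) (snd c) \<and>
        (\<forall>x\<in>snd c ` fst c. immersive_at (open_region (snd c ` fst c)) M (chart_inv c) x)}\<rparr>"

text \<open>The structure on the image of \<open>f\<close> for which \<open>f\<close> is a submersion: if there is one, its charts
  are the injective maps \<open>\<phi>\<close> defined on an open set \<open>U\<close> such that \<open>\<phi> \<circ> f\<close> is a submersion.\<close>

definition quotient_manifold ::
  "('a, 'e::euclidean_space, 'm) manifold_data_scheme \<Rightarrow> ('a \<Rightarrow> 'b)
   \<Rightarrow> ('b, 'f::euclidean_space) manifold_data" where
  "quotient_manifold M f =
     \<lparr>points = f ` points M,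
      charts = {c. fst c \<subseteq> f ` points M \<and> openin (mtop M) {x \<in> points M. f x \<in> fst c} \<and>
        inj_on (snd c) (fst c) \<and> open (snd c ` fst c) \<and>
        (\<forall>x\<in>points M. f x \<in> fst c \<longrightarrow> submersive_at M (open_region UNIV) (snd c \<circ> f) x)}\<rparr>"

record ('a, 'e) contact_data = "('a, 'e) manifold_data" +
  hyperplane :: "'a \<Rightarrow> ('a, 'e) tangent set"

text \<open>In the chart \<open>c\<close>, the one-form \<open>\<alpha>\<^sub>x(v) = a x \<bullet> v\<close> has no zeros and its kernel over \<open>W\<close> is \<open>\<xi>\<close>.\<close>

definition local_defining_form ::
  "('a, 'e::euclidean_space) contact_data \<Rightarrow> ('a, 'e) chart \<Rightarrow> 'a set \<Rightarrow> ('e \<Rightarrow> 'e) \<Rightarrow> bool" where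
  "local_defining_form Q c W a \<longleftrightarrow>
     c \<in> charts Q \<and> openin (mtop Q) W \<and> W \<subseteq> fst c \<and> smooth_on (snd c ` W) a \<and>
     (\<forall>q\<in>W. a (snd c q) \<noteq> 0 \<and>
        hyperplane Q q = {v \<in> tangent_space Q q. a (snd c q) \<bullet> v c = 0})"

definition hyperplane_distribution :: "('a, 'e::euclidean_space) contact_data \<Rightarrow> bool" where
  "hyperplane_distribution Q \<longleftrightarrow>
     (\<forall>p\<in>points Q. \<exists>c W a. p \<in> W \<and> local_defining_form Q c W a)"

text \<open>The exterior derivative of \<open>\<alpha>\<^sub>x(v) = a x \<bullet> v\<close>.\<close>

definition exterior_derivative ::
  "('e::euclidean_space \<Rightarrow> 'e) \<Rightarrow> 'e \<Rightarrow> 'e \<Rightarrow> 'e \<Rightarrow> real" where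
  "exterior_derivative a x v w =
     frechet_derivative a (at x) v \<bullet> w - frechet_derivative a (at x) w \<bullet> v"

text \<open>Maximal non-integrability: \<open>d\<alpha>\<close> is nondegenerate on \<open>\<xi> = ker \<alpha>\<close> for all local defining forms.\<close>

definition maximally_nonintegrable :: "('a, 'e::euclidean_space) contact_data \<Rightarrow> bool" where
  "maximally_nonintegrable Q \<longleftrightarrow>
     (\<forall>c W a. local_defining_form Q c W a \<longrightarrow>
        (\<forall>q\<in>W. \<forall>v\<in>hyperplane Q q. v c \<noteq> 0 \<longrightarrow>
           (\<exists>w\<in>hyperplane Q q. exterior_derivative a (snd c q) (v c) (w c) \<noteq> 0)))"

definition contact_manifold :: "('a, 'e::euclidean_space) contact_data \<Rightarrow> bool" where
  "contact_manifold Q \<longleftrightarrow>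
     smooth_manifold Q \<and> hyperplane_distribution Q \<and> maximally_nonintegrable Q"

definition symplectization ::
  "('a, 'e::euclidean_space) contact_data \<Rightarrow> (('a, 'e) covector, 'e \<times> real) manifold_data" where
  "symplectization Q = embedded_submanifold (cotangent_bundle Q)
     {(p, \<beta>) \<in> points (cotangent_bundle Q). \<beta> \<noteq> (\<lambda>_. 0) \<and> (\<forall>v\<in>hyperplane Q p. \<beta> v = 0)}"

definition bundle_projection :: "('a, 'e) covector \<Rightarrow> 'a" where
  "bundle_projection = fst"

text \<open>\<open>\<theta>\<close> at \<open>z = (p, \<beta>)\<close> is \<open>\<beta>\<close> composed with the differential of the bundle projection, here already
  restricted to the symplectization.\<close>

definition liouville_form ::
  "('a, 'e::euclidean_space) contact_data \<Rightarrow> ('a, 'e) covector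
   \<Rightarrow> (('a, 'e) covector, 'e \<times> real) tangent \<Rightarrow> real" where
  "liouville_form Q z w = snd z (differential (symplectization Q) Q bundle_projection z w)"

definition symplectization_product ::
  "('a, 'e::euclidean_space) contact_data \<Rightarrow> ('b, 'f::euclidean_space) contact_data \<Rightarrow>
   (('a, 'e) covector \<times> ('b, 'f) covector, ('e \<times> real) \<times> ('f \<times> real)) manifold_data" where
  "symplectization_product Q0 Q1 = product_manifold (symplectization Q0) (symplectization Q1)"

definition sum_liouville_form ::
  "('a, 'e::euclidean_space) contact_data \<Rightarrow> ('b, 'f::euclidean_space) contact_data \<Rightarrow>
   ('a, 'e) covector \<times> ('b, 'f) covector \<Rightarrow>
   (('a, 'e) covector \<times> ('b, 'f) covector, ('e \<times> real) \<times> ('f \<times> real)) tangent \<Rightarrow> real" where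
  "sum_liouville_form Q0 Q1 z w =
     liouville_form Q0 (fst z)
       (differential (symplectization_product Q0 Q1) (symplectization Q0) fst z w) +
     liouville_form Q1 (snd z)
       (differential (symplectization_product Q0 Q1) (symplectization Q1) snd z w)"

text \<open>The diagonal action of the positive reals; the quotient map sends a point to its orbit.\<close>

definition rescale :: "real \<Rightarrow> ('a, 'e) covector \<Rightarrow> ('a, 'e) covector" where
  "rescale r = (\<lambda>(p, \<beta>). (p, \<lambda>v. r * \<beta> v))"

definition orbit_map ::
  "('a, 'e) covector \<times> ('b, 'f) covector \<Rightarrow> (('a, 'e) covector \<times> ('b, 'f) covector) set" where
  "orbit_map z = {(rescale r (fst z), rescale r (snd z)) | r. r > 0}"

text \<open>The dimension of the contact product is \<open>dim Q\<^sub>0 + dim Q\<^sub>1 + 1\<close>, which determines its model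
  space.\<close>

definition contact_product ::
  "('a, 'e::euclidean_space) contact_data \<Rightarrow> ('b, 'f::euclidean_space) contact_data \<Rightarrow>
   ((('a, 'e) covector \<times> ('b, 'f) covector) set, 'e \<times> 'f \<times> real) contact_data" where
  "contact_product Q0 Q1 =
     (let P = symplectization_product Q0 Q1; N = quotient_manifold P orbit_map in
      \<lparr>points = points N, charts = charts N,
       hyperplane = (\<lambda>y. {differential P N orbit_map z w | z w.
          z \<in> points P \<and> orbit_map z = y \<and> w \<in> tangent_space P z \<and>
          sum_liouville_form Q0 Q1 z w = 0})\<rparr>)"

definition proj0 :: "('a, 'e) covector \<times> ('b, 'f) covector \<Rightarrow> 'a" where
  "proj0 = bundle_projection \<circ> fst"

definition proj1 :: "('a, 'e) covector \<times> ('b, 'f) covector \<Rightarrow> 'b" where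
  "proj1 = bundle_projection \<circ> snd"

end

theory Submission
  imports Defs
begin

text \<open>The action rescales covectors and leaves base points alone, so the maps
  \<open>(\<beta>\<^sub>0, \<beta>\<^sub>1) \<mapsto> q\<^sub>i\<close> are constant on orbits. They factor through the quotient, uniquely because the
  quotient map is onto. They reach all of \<open>Q\<^sub>i\<close> when the other factor is nonempty, since every fibre of
  a symplectization is nonempty. What takes work is that the factored maps are smooth submersions for
  the given smooth structure of the quotient, i.e. that there are enough charts in which to look at
  them.

  These charts come from local defining forms \<open>\<alpha>\<^sub>i\<close> of the contact structures, taken with the signs for
  which the given covectors are positive multiples of them. Over the domain of \<open>\<alpha>\<^sub>i\<close>, the covectors
  \<open>e\<^sup>s \<alpha>\<^sub>i\<close> form an open subset of \<open>SQ\<^sub>i\<close>, and \<open>(x\<^sub>i, s\<^sub>i)\<close> are coordinates on it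
  (\<open>log_chart_in_charts\<close>, \<open>symplectization_covered\<close>). The action translates \<open>s\<^sub>0\<close> and \<open>s\<^sub>1\<close> by the same
  amount, so \<open>(x\<^sub>0, x\<^sub>1, s\<^sub>1 - s\<^sub>0)\<close> are coordinates on the quotient (\<open>orbit_chart_in_charts\<close>). In
  these coordinates the quotient map and both projections are linear and onto, hence submersions.
  The logarithmic coordinate is chosen for this linearity; it parametrizes one of the two components
  of \<open>SQ\<^sub>i\<close> over a small set at a time.

  Two topological points need an argument. That logarithmic charts belong to the atlas of the
  embedded submanifold \<open>SQ\<^sub>i\<close> requires to know the topology of the cotangent bundle, i.e. that its
  induced charts are homeomorphisms; this follows from the continuity of their coordinate changes
  (\<open>homeomorphic_map_cotangent_chart\<close>). That the domain of an orbit chart is open in the quotient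
  refers to all charts of the quotient, and is a consequence of the openness of submersions
  (\<open>openin_mtop_quotient\<close>).\<close>

section \<open>Smooth maps between Euclidean spaces\<close>

lemma ck_on_imp_differentiable: "ck_on (Suc k) S f \<Longrightarrow> x \<in> S \<Longrightarrow> f differentiable (at x)"
  by simp

lemma ck_on_Suc_imp: "ck_on (Suc k) S f \<Longrightarrow> ck_on k S f"
proof (induction k arbitrary: f)
  case 0
  then show ?case
    by (auto intro!: continuous_at_imp_continuous_on differentiable_imp_continuous_within)
next
  case (Suc k)
  have D: "\<forall>x\<in>S. f differentiable (at x)"
      "\<And>v. ck_on (Suc k) S (\<lambda>x. frechet_derivative f (at x) v)"
    using Suc.prems unfolding ck_on.simps(2)[of "Suc k"] by blast+
  from Suc.IH[OF D(2)] D(1) show ?case by simp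
qed

lemma ck_on_cong:
  assumes "open S" "\<And>x. x \<in> S \<Longrightarrow> f x = g x" "ck_on k S f"
  shows "ck_on k S g"
  using assms(2,3)
proof (induction k arbitrary: f g)
  case 0
  then show ?case by (auto cong: continuous_on_cong)
next
  case (Suc k)
  have D: "f differentiable (at x)" if "x \<in> S" for x using Suc.prems that by simp
  have eq: "frechet_derivative f (at x) = frechet_derivative g (at x)" if "x \<in> S" for x
    using frechet_derivative_transform_within_open[OF D \<open>open S\<close> that] Suc.prems(1) that by blast
  have "g differentiable (at x)" if "x \<in> S" for x
    using D[OF that] has_derivative_transform_within_open[OF _ \<open>open S\<close> that] Suc.prems(1)
    unfolding differentiable_def by blast
  moreover have "ck_on k S (\<lambda>x. frechet_derivative g (at x) v)" for v
    by (rule Suc.IH[of "\<lambda>x. frechet_derivative f (at x) v"]) (use Suc.prems eq in auto)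
  ultimately show ?case by simp
qed

lemma ck_on_const: "ck_on k S (\<lambda>x. c)"
  by (induction k arbitrary: c) auto

lemma ck_on_bounded_linear:
  assumes "bounded_linear f"
  shows "ck_on k S f"
proof (cases k)
  case 0
  then show ?thesis using assms by (simp add: bounded_linear.linear linear_continuous_on assms)
next
  case (Suc j)
  have D: "(f has_derivative f) (at x)" for x using assms by (rule bounded_linear_imp_has_derivative)
  then have "frechet_derivative f (at x) = f" for x using frechet_derivative_at by metis
  moreover have "f differentiable (at x)" for x using D unfolding differentiable_def by blast
  ultimately show ?thesis by (simp add: Suc ck_on_const)
qed

text \<open>The definition of \<open>ck_on\<close> speaks of \<^const>\<open>frechet_derivative\<close>, a choice operator; on an
  open set it may be replaced by any explicitly known derivative, which is how all induction steps
  below are done.\<close>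

lemma ck_on_SucI:
  assumes "open S" "\<And>x. x \<in> S \<Longrightarrow> (f has_derivative f' x) (at x)" "\<And>v. ck_on k S (\<lambda>x. f' x v)"
  shows "ck_on (Suc k) S f"
proof -
  have "f' x = frechet_derivative f (at x)" if "x \<in> S" for x
    by (rule frechet_derivative_at) (use assms(2) that in blast)
  then have "ck_on k S (\<lambda>x. frechet_derivative f (at x) v)" for v
    by (intro ck_on_cong[OF assms(1) _ assms(3)[of v]]) simp
  moreover have "f differentiable (at x)" if "x \<in> S" for x
    using assms(2)[OF that] by (rule differentiableI)
  ultimately show ?thesis by simp
qed

lemma ck_on_has_derivative:
  "ck_on (Suc k) S f \<Longrightarrow> x \<in> S \<Longrightarrow> (f has_derivative frechet_derivative f (at x)) (at x)"
  using ck_on_imp_differentiable frechet_derivative_works by blast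

lemma ck_on_add:
  assumes "open S" "ck_on k S f" "ck_on k S g"
  shows "ck_on k S (\<lambda>x. f x + g x)"
  using assms(2,3)
proof (induction k arbitrary: f g)
  case 0
  then show ?case by (auto intro: continuous_intros)
next
  case (Suc k)
  show ?case
    by (rule ck_on_SucI[OF assms(1)
          has_derivative_add[OF ck_on_has_derivative[OF Suc.prems(1)] ck_on_has_derivative[OF Suc.prems(2)]]])
       (use Suc in auto)
qed

lemma ck_on_scaleR:
  assumes "open S" "ck_on k S f"
  shows "ck_on k S (\<lambda>x. r *\<^sub>R f x)"
  using assms(2)
proof (induction k arbitrary: f)
  case 0
  then show ?case by (auto intro: continuous_intros)
next
  case (Suc k)
  show ?case
    by (rule ck_on_SucI[OF assms(1) has_derivative_scaleR_right[OF ck_on_has_derivative[OF Suc.prems]]])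
       (use Suc in auto)
qed

lemma ck_on_Pair:
  assumes "open S" "ck_on k S f" "ck_on k S g"
  shows "ck_on k S (\<lambda>x. (f x, g x))"
  using assms(2,3)
proof (induction k arbitrary: f g)
  case 0
  then show ?case by (auto intro: continuous_intros)
next
  case (Suc k)
  show ?case
    by (rule ck_on_SucI[OF assms(1)
          has_derivative_Pair[OF ck_on_has_derivative[OF Suc.prems(1)] ck_on_has_derivative[OF Suc.prems(2)]]])
       (use Suc in auto)
qed

lemma has_derivative_exp_scale:
  fixes a :: "'e::euclidean_space \<Rightarrow> 'f::euclidean_space"
  assumes "(a has_derivative a') (at (fst z))"
  shows "((\<lambda>z. exp (snd z) *\<^sub>R a (fst z)) has_derivative
          (\<lambda>v. exp (snd z) *\<^sub>R (a' (fst v) + snd v *\<^sub>R a (fst z)))) (at z)"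
proof -
  have 1: "((\<lambda>z. a (fst z)) has_derivative (\<lambda>v. a' (fst v))) (at z)"
    by (rule has_derivative_compose[OF has_derivative_fst[OF has_derivative_ident]])
       (use assms in simp)
  have 2: "((\<lambda>z. exp (snd z)) has_derivative (\<lambda>v. exp (snd z) * snd v)) (at z)"
    by (auto intro!: derivative_eq_intros)
  show ?thesis
    by (rule has_derivative_eq_rhs[OF has_derivative_scaleR[OF 2 1]]) (auto simp: algebra_simps)
qed

text \<open>Functions of the form \<open>(x, s) \<mapsto> e\<^sup>s a(x)\<close> are closed under directional derivatives, which
  makes their smoothness an induction without any product rule for higher derivatives.\<close>

lemma ck_on_exp_scale:
  fixes a :: "'e::euclidean_space \<Rightarrow> 'f::euclidean_space"
  assumes "open S" "ck_on k S a"
  shows "ck_on k (S \<times> UNIV) (\<lambda>z. exp (snd z) *\<^sub>R a (fst z))"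
  using assms(2)
proof (induction k arbitrary: a)
  case 0
  then have "continuous_on (S \<times> UNIV) (\<lambda>z. a (fst z))"
    by (intro continuous_on_compose2[of S a _ fst] continuous_on_fst continuous_on_id) auto
  then show ?case unfolding ck_on.simps(1)
    by (intro continuous_on_scaleR continuous_on_exp continuous_on_snd continuous_on_id)
next
  case (Suc k)
  have o: "open (S \<times> (UNIV::real set))" using assms(1) by (simp add: open_Times)
  let ?f' = "\<lambda>z v. exp (snd z) *\<^sub>R (frechet_derivative a (at (fst z)) (fst v) + snd v *\<^sub>R a (fst z))"
  show ?case
  proof (rule ck_on_SucI[OF o, of _ ?f'])
    show "((\<lambda>z. exp (snd z) *\<^sub>R a (fst z)) has_derivative ?f' z) (at z)"
      if "z \<in> S \<times> UNIV" for z
      by (rule has_derivative_exp_scale) (use that ck_on_has_derivative[OF Suc.prems] in auto)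
    show "ck_on k (S \<times> UNIV) (\<lambda>z. ?f' z v)" for v
    proof -
      have "ck_on k S (\<lambda>x. frechet_derivative a (at x) (fst v) + snd v *\<^sub>R a x)"
        using Suc.prems ck_on_Suc_imp[OF Suc.prems]
        by (intro ck_on_add ck_on_scaleR assms(1)) auto
      from Suc.IH[OF this] show ?thesis by simp
    qed
  qed
qed

lemma smooth_on_cong: "open S \<Longrightarrow> (\<And>x. x \<in> S \<Longrightarrow> f x = g x) \<Longrightarrow> smooth_on S f \<Longrightarrow> smooth_on S g"
  unfolding smooth_on_def using ck_on_cong by blast

lemma smooth_on_bounded_linear: "bounded_linear f \<Longrightarrow> smooth_on S f"
  unfolding smooth_on_def using ck_on_bounded_linear by blast

lemma smooth_on_has_derivative:
  "smooth_on S f \<Longrightarrow> x \<in> S \<Longrightarrow> (f has_derivative frechet_derivative f (at x)) (at x)"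
  unfolding smooth_on_def using ck_on_has_derivative by blast

lemma smooth_on_imp_continuous_on: "smooth_on S f \<Longrightarrow> continuous_on S f"
  unfolding smooth_on_def using ck_on.simps(1) by blast

lemma smooth_on_imp_continuous_on_derivative:
  "smooth_on S f \<Longrightarrow> continuous_on S (\<lambda>x. frechet_derivative f (at x) v)"
  unfolding smooth_on_def using ck_on.simps(1) ck_on.simps(2)[of 0 S f] by blast

section \<open>Charts and coordinate expressions of maps\<close>

lemma chart_inv_image: "inj_on (snd c) (fst c) \<Longrightarrow> p \<in> fst c \<Longrightarrow> chart_inv c (snd c p) = p"
  unfolding chart_inv_def by simp

lemma inj_on_charts:
  "smooth_manifold M \<Longrightarrow> c \<in> charts M \<Longrightarrow> inj_on (snd c) (fst c)"
  unfolding smooth_manifold_def by blast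

text \<open>In practice \<open>f\<close> is known through an explicit formula \<open>g\<close> in coordinates. Since the image of \<open>W\<close>
  is open, agreement there transfers smoothness and the derivative from \<open>g\<close> to the coordinate
  expression of \<open>f\<close>, whose values elsewhere are arbitrary.\<close>

lemma smooth_at_with_coordinatesI:
  assumes "c \<in> charts_at M p" "d \<in> charts_at N (f p)" "inj_on (snd c) (fst c)"
    and "openin (mtop M) W" "p \<in> W" "W \<subseteq> fst c" "f ` W \<subseteq> fst d" "open (snd c ` W)"
    and "\<And>q. q \<in> W \<Longrightarrow> snd d (f q) = g (snd c q)"
    and "smooth_on (snd c ` W) g" "(g has_derivative g') (at (snd c p))" "P g'"
  shows "smooth_at_with P M N f p"
proof -
  have eq: "(snd d \<circ> f \<circ> chart_inv c) x = g x" if "x \<in> snd c ` W" for x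
    using that assms(3,6,9) by (auto simp: chart_inv_image subset_iff)
  have "((snd d \<circ> f \<circ> chart_inv c) has_derivative g') (at (snd c p))"
    by (rule has_derivative_transform_within_open[OF assms(11,8)]) (use assms(5) eq in auto)
  then have "frechet_derivative (snd d \<circ> f \<circ> chart_inv c) (at (snd c p)) = g'"
    using frechet_derivative_at by metis
  moreover have "smooth_on (snd c ` W) (snd d \<circ> f \<circ> chart_inv c)"
    by (rule smooth_on_cong[OF assms(8) _ assms(10)]) (use eq in auto)
  ultimately show ?thesis using assms unfolding smooth_at_with_def by blast
qed

lemma openin_open_region: "open S \<Longrightarrow> openin (mtop (open_region S)) W \<longleftrightarrow> W \<subseteq> S \<and> open W"
  by (subst openin_mtop) (auto simp: open_region_def Int_absorb2)

text \<open>Continuity of the coordinate changes makes all charts agree on which sets are open: seen in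
  another chart, \<open>V\<close> is the preimage of its image under a coordinate change. Stating this for atlases
  that are merely continuous allows to apply it to the cotangent bundle.\<close>

lemma openin_mtop_chart_subset:
  assumes inj: "\<And>c. c \<in> charts M \<Longrightarrow> inj_on (snd c) (fst c)"
    and op: "\<And>c d. c \<in> charts M \<Longrightarrow> d \<in> charts M \<Longrightarrow> open (snd c ` (fst c \<inter> fst d))"
    and cont: "\<And>c d. c \<in> charts M \<Longrightarrow> d \<in> charts M \<Longrightarrow>
      continuous_on (snd c ` (fst c \<inter> fst d)) (snd d \<circ> chart_inv c)"
    and c: "c \<in> charts M" and V: "V \<subseteq> fst c" "V \<subseteq> points M" "open (snd c ` V)"
  shows "openin (mtop M) V"
proof -
  have "open (snd d ` (V \<inter> fst d))" if d: "d \<in> charts M" for d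
  proof -
    have "open (snd d ` (fst d \<inter> fst c) \<inter> (snd c \<circ> chart_inv d) -` (snd c ` V))"
      by (rule continuous_open_preimage[OF cont[OF d c] op[OF d c] V(3)])
    also have "snd d ` (fst d \<inter> fst c) \<inter> (snd c \<circ> chart_inv d) -` (snd c ` V) = snd d ` (V \<inter> fst d)"
    proof -
      have "p \<in> V" if "p \<in> fst c" "snd c p \<in> snd c ` V" for p
        using that inj[OF c] V(1) by (metis inj_on_image_mem_iff)
      then show ?thesis using V(1) by (auto simp: chart_inv_image inj[OF d])
    qed
    finally show ?thesis .
  qed
  then show ?thesis using V(2) by (simp add: openin_mtop[OF inj])
qed

lemma homeomorphic_map_chart:
  assumes inj: "\<And>c. c \<in> charts M \<Longrightarrow> inj_on (snd c) (fst c)"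
    and op: "\<And>c d. c \<in> charts M \<Longrightarrow> d \<in> charts M \<Longrightarrow> open (snd c ` (fst c \<inter> fst d))"
    and cont: "\<And>c d. c \<in> charts M \<Longrightarrow> d \<in> charts M \<Longrightarrow>
      continuous_on (snd c ` (fst c \<inter> fst d)) (snd d \<circ> chart_inv c)"
    and c: "c \<in> charts M" and sub: "fst c \<subseteq> points M" and A: "A \<subseteq> fst c"
  shows "homeomorphic_map (subtopology (mtop M) A) (top_of_set (snd c ` A)) (snd c)"
proof -
  note opens = openin_mtop_chart_subset[OF inj op cont c]
  have oc: "open (snd c ` fst c)" using op[OF c c] by simp
  have dom: "openin (mtop M) (fst c)" using opens[of "fst c"] sub oc by simp
  then have ts: "topspace (mtop M) \<inter> fst c = fst c" using openin_subset by blast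
  have iff: "openin (subtopology (mtop M) (fst c)) V \<longleftrightarrow> V \<subseteq> fst c \<and> open (snd c ` V)" for V
    using openin_open_subtopology[OF dom] opens[of V] sub openin_mtop[OF inj, of M V] c
    by (metis Int_absorb2 order_trans)
  have "homeomorphic_map (subtopology (mtop M) (fst c)) (top_of_set (snd c ` fst c)) (snd c)"
  proof (rule bijective_open_imp_homeomorphic_map)
    show "continuous_map (subtopology (mtop M) (fst c)) (top_of_set (snd c ` fst c)) (snd c)"
      unfolding continuous_map_def
    proof (intro conjI allI impI)
      fix U assume "openin (top_of_set (snd c ` fst c)) U"
      then have U: "open U" "U \<subseteq> snd c ` fst c" using oc by (auto simp: openin_open_eq)
      have "snd c ` {x \<in> fst c. snd c x \<in> U} = U" using U(2) by auto
      then show "openin (subtopology (mtop M) (fst c))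
          {x \<in> topspace (subtopology (mtop M) (fst c)). snd c x \<in> U}"
        using U by (simp add: iff ts)
    qed (auto simp: ts)
    show "open_map (subtopology (mtop M) (fst c)) (top_of_set (snd c ` fst c)) (snd c)"
      using oc by (auto simp: open_map_def iff openin_open_eq)
  qed (use ts inj[OF c] in auto)
  from homeomorphic_map_subtopologies[OF this, of A "snd c ` A"]
  have "homeomorphic_map (subtopology (subtopology (mtop M) (fst c)) A)
      (subtopology (top_of_set (snd c ` fst c)) (snd c ` A)) (snd c)"
    using A ts by (auto simp: Int_absorb1 Int_absorb2 image_mono)
  then show ?thesis
    using A by (simp add: subtopology_subtopology Int_absorb1 image_mono)
qed

text \<open>A smooth map between Euclidean spaces whose derivative at \<open>x\<close> is onto is open near \<open>x\<close>:
  a linear right inverse of the derivative is what the open mapping theorem asks for.\<close>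

lemma submersion_image_interior:
  fixes f :: "'e::euclidean_space \<Rightarrow> 'f::euclidean_space"
  assumes "open S" "smooth_on S f" "surj (frechet_derivative f (at x))"
    and "open T" "x \<in> T" "T \<subseteq> S"
  shows "f x \<in> interior (f ` T)"
proof -
  have x: "x \<in> S" using assms by blast
  note D = smooth_on_has_derivative[OF assms(2) x]
  obtain g where g: "linear g" "frechet_derivative f (at x) \<circ> g = id"
    using linear_surjective_right_inverse[OF has_derivative_linear[OF D] assms(3)] by blast
  show ?thesis
    by (rule sussmann_open_mapping[OF assms(1) smooth_on_imp_continuous_on[OF assms(2)] x D _ g(2)])
       (use assms g linear_conv_bounded_linear in \<open>auto simp: interior_open\<close>)
qed

text \<open>For a set to be open in the quotient, its images in all quotient charts \<open>d\<close> have to be open.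
  Nothing is known about \<open>d\<close> except that \<open>d \<circ> f\<close> is a submersion; but the image of \<open>Y\<close> in \<open>d\<close> is also
  the image of an open set of \<open>M\<close> under \<open>d \<circ> f\<close>, and submersions are open maps.\<close>

lemma openin_mtop_quotient:
  fixes M :: "('a, 'e::euclidean_space, 'm) manifold_data_scheme"
  assumes inj: "\<And>c. c \<in> charts M \<Longrightarrow> inj_on (snd c) (fst c)"
    and Y: "Y \<subseteq> f ` points M" "openin (mtop M) {x \<in> points M. f x \<in> Y}"
  shows "openin (mtop (quotient_manifold M f :: ('b, 'f::euclidean_space) manifold_data)) Y"
proof -
  let ?N = "quotient_manifold M f :: ('b, 'f) manifold_data"
  have "open (snd d ` (Y \<inter> fst d))" if d: "d \<in> charts ?N" for d
  proof -
    \<comment> \<open>the part of \<open>M\<close> lying over \<open>Y\<close> and over the domain of \<open>d\<close>\<close>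
    let ?U = "{x \<in> points M. f x \<in> Y} \<inter> {x \<in> points M. f x \<in> fst d}"
    have U: "openin (mtop M) ?U"
      using Y(2) d by (auto simp: quotient_manifold_def intro: openin_Int)
    have "z \<in> interior (snd d ` (Y \<inter> fst d))" if z: "z \<in> snd d ` (Y \<inter> fst d)" for z
    proof -
      obtain y where y: "y \<in> Y" "y \<in> fst d" "z = snd d y" using z by blast
      then obtain x where "x \<in> points M" "y = f x" using Y(1) by blast
      with y have x: "x \<in> ?U" "z = snd d (f x)" by auto
      have "submersive_at M (open_region UNIV) (snd d \<circ> f) x"
        using d x by (auto simp: quotient_manifold_def)
      then obtain c W where c: "c \<in> charts M" and W: "openin (mtop M) W" "x \<in> W" "W \<subseteq> fst c"
        and sm: "smooth_on (snd c ` W) (snd d \<circ> f \<circ> chart_inv c)"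
        and su: "surj (frechet_derivative (snd d \<circ> f \<circ> chart_inv c) (at (snd c x)))"
        unfolding smooth_at_with_def charts_at_def open_region_def by (auto simp: o_assoc)
      have op: "open (snd c ` V)" if "openin (mtop M) V" "V \<subseteq> W" for V
      proof -
        have "V \<inter> fst c = V" using that(2) W(3) by blast
        moreover have "open (snd c ` (V \<inter> fst c))"
          using that(1) c openin_mtop[OF inj] by blast
        ultimately show ?thesis by simp
      qed
      have VU: "open (snd c ` (W \<inter> ?U))"
        by (rule op) (use W(1) U in \<open>auto intro: openin_Int\<close>)
      have inv: "chart_inv c (snd c q) = q" if "q \<in> W" for q
        using that W(3) chart_inv_image[OF inj[OF c]] by blast
      have int: "(snd d \<circ> f \<circ> chart_inv c) (snd c x)
          \<in> interior ((snd d \<circ> f \<circ> chart_inv c) ` (snd c ` (W \<inter> ?U)))"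
        by (rule submersion_image_interior[OF op[OF W(1) order_refl] sm su VU])
           (use x W in auto)
      have sub: "(snd d \<circ> f \<circ> chart_inv c) ` (snd c ` (W \<inter> ?U)) \<subseteq> snd d ` (Y \<inter> fst d)"
        using inv by auto
      have "(snd d \<circ> f \<circ> chart_inv c) (snd c x) = z" using x inv W(2) by simp
      with subsetD[OF interior_mono[OF sub] int] show ?thesis by (simp only:)
    qed
    then have "interior (snd d ` (Y \<inter> fst d)) = snd d ` (Y \<inter> fst d)"
      using interior_subset by blast
    then show ?thesis by (simp only: interior_eq)
  qed
  moreover have "inj_on (snd c) (fst c)" if "c \<in> charts ?N" for c
    using that by (simp add: quotient_manifold_def)
  moreover have "Y \<subseteq> points ?N" using Y(1) by (simp add: quotient_manifold_def)
  ultimately show ?thesis by (simp add: openin_mtop)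
qed

section \<open>Tangent vectors and covectors in coordinates\<close>

lemma open_chart_overlap:
  "smooth_manifold M \<Longrightarrow> c \<in> charts M \<Longrightarrow> d \<in> charts M \<Longrightarrow> open (snd c ` (fst c \<inter> fst d))"
  unfolding smooth_manifold_def by blast

lemma smooth_transition:
  "smooth_manifold M \<Longrightarrow> c \<in> charts M \<Longrightarrow> d \<in> charts M \<Longrightarrow>
    smooth_on (snd c ` (fst c \<inter> fst d)) (snd d \<circ> chart_inv c)"
  unfolding smooth_manifold_def by blast

lemma transition_has_derivative:
  assumes "smooth_manifold M" "c \<in> charts_at M p" "d \<in> charts_at M p"
  shows "((snd d \<circ> chart_inv c) has_derivative
          frechet_derivative (snd d \<circ> chart_inv c) (at (snd c p))) (at (snd c p))"
  by (rule smooth_on_has_derivative[OF smooth_transition[OF assms(1)]])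
     (use assms in \<open>auto simp: charts_at_def\<close>)

lemma transition_linear:
  assumes "smooth_manifold M" "c \<in> charts_at M p" "d \<in> charts_at M p"
  shows "linear (frechet_derivative (snd d \<circ> chart_inv c) (at (snd c p)))"
  using transition_has_derivative[OF assms] has_derivative_linear by blast

lemma transition_self:
  assumes M: "smooth_manifold M" and c: "c \<in> charts_at M p"
  shows "frechet_derivative (snd c \<circ> chart_inv c) (at (snd c p)) = (\<lambda>v. v)"
proof -
  have c': "c \<in> charts M" "p \<in> fst c" using c by (auto simp: charts_at_def)
  have "((snd c \<circ> chart_inv c) has_derivative (\<lambda>v. v)) (at (snd c p))"
    by (rule has_derivative_transform_within_open[OF has_derivative_ident
          open_chart_overlap[OF M c'(1) c'(1)]])
       (use c' chart_inv_image[OF inj_on_charts[OF M c'(1)]] in auto)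
  then show ?thesis using frechet_derivative_at by metis
qed

text \<open>The chain rule for \<open>e \<circ> c\<^sup>-\<^sup>1 = (e \<circ> d\<^sup>-\<^sup>1) \<circ> (d \<circ> c\<^sup>-\<^sup>1)\<close> near \<open>p\<close>. It ensures that every
  vector of the model space is the component in \<open>c\<close> of a tangent vector.\<close>

lemma transition_cocycle:
  assumes M: "smooth_manifold M"
    and c: "c \<in> charts_at M p" and d: "d \<in> charts_at M p" and e: "e \<in> charts_at M p"
  shows "frechet_derivative (snd e \<circ> chart_inv c) (at (snd c p)) v =
         frechet_derivative (snd e \<circ> chart_inv d) (at (snd d p))
           (frechet_derivative (snd d \<circ> chart_inv c) (at (snd c p)) v)"
proof -
  have *: "c \<in> charts M" "p \<in> fst c" "d \<in> charts M" "p \<in> fst d"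
    using c d by (auto simp: charts_at_def)
  note inv = chart_inv_image[OF inj_on_charts[OF M *(1)]] chart_inv_image[OF inj_on_charts[OF M *(3)]]
  have dp: "snd d p = (snd d \<circ> chart_inv c) (snd c p)" using *(2) inv by simp
  have "((\<lambda>x. (snd e \<circ> chart_inv d) ((snd d \<circ> chart_inv c) x)) has_derivative
      (\<lambda>v. frechet_derivative (snd e \<circ> chart_inv d) (at (snd d p))
           (frechet_derivative (snd d \<circ> chart_inv c) (at (snd c p)) v))) (at (snd c p))"
    by (rule has_derivative_compose[OF transition_has_derivative[OF M c d]])
       (use transition_has_derivative[OF M d e] in \<open>simp only: dp[symmetric]\<close>)
  then have "((snd e \<circ> chart_inv c) has_derivative
      (\<lambda>v. frechet_derivative (snd e \<circ> chart_inv d) (at (snd d p))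
           (frechet_derivative (snd d \<circ> chart_inv c) (at (snd c p)) v))) (at (snd c p))"
    by (rule has_derivative_transform_within_open[OF _ open_chart_overlap[OF M *(1) *(3)]])
       (use * inv in auto)
  from fun_cong[OF frechet_derivative_at[OF this], of v] show ?thesis by (simp only:)
qed

lemma coordinate_vector_in_tangent_space:
  assumes M: "smooth_manifold M" and c: "c \<in> charts_at M p"
  shows "coordinate_vector M p c v \<in> tangent_space M p"
  unfolding tangent_space_def mem_Collect_eq
proof (intro conjI allI impI ballI)
  fix d e assume "d \<in> charts_at M p" "e \<in> charts_at M p"
  with transition_cocycle[OF M c this]
  show "coordinate_vector M p c v e =
      frechet_derivative (snd e \<circ> chart_inv d) (at (snd d p)) (coordinate_vector M p c v d)"
    unfolding coordinate_vector_def by (simp only: if_True)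
qed (simp add: coordinate_vector_def)

lemma coordinate_vector_component:
  assumes "smooth_manifold M" "c \<in> charts_at M p"
  shows "coordinate_vector M p c v c = v"
  using assms transition_self[OF assms] by (simp add: coordinate_vector_def)

lemma coordinate_vector_of_component:
  assumes v: "v \<in> tangent_space M p" and c: "c \<in> charts_at M p"
  shows "coordinate_vector M p c (v c) = v"
proof
  fix d
  show "coordinate_vector M p c (v c) d = v d"
  proof (cases "d \<in> charts_at M p")
    case True
    then have "v d = frechet_derivative (snd d \<circ> chart_inv c) (at (snd c p)) (v c)"
      using v c unfolding tangent_space_def by blast
    with True show ?thesis by (simp add: coordinate_vector_def)
  next
    case False
    then have "v d = 0" using v unfolding tangent_space_def by blast
    with False show ?thesis by (simp add: coordinate_vector_def)
  qed
qed

lemma coordinate_vector_combination: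
  assumes "smooth_manifold M" "c \<in> charts_at M p"
  shows "coordinate_vector M p c (s *\<^sub>R v + t *\<^sub>R w) =
         (\<lambda>d. s *\<^sub>R coordinate_vector M p c v d + t *\<^sub>R coordinate_vector M p c w d)"
  using transition_linear[OF assms]
  by (auto simp: coordinate_vector_def fun_eq_iff linear_add linear_scale)

lemma tangent_space_combination:
  assumes M: "smooth_manifold M" and c: "c \<in> charts_at M p"
    and "v \<in> tangent_space M p" "w \<in> tangent_space M p"
  shows "(\<lambda>d. s *\<^sub>R v d + t *\<^sub>R w d) \<in> tangent_space M p"
  using coordinate_vector_in_tangent_space[OF M c, of "s *\<^sub>R v c + t *\<^sub>R w c"] assms(3,4)
  by (simp add: coordinate_vector_combination[OF M c] coordinate_vector_of_component[OF _ c])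

text \<open>The fibre part of \<^const>\<open>cotangent_chart\<close>, and next to it its inverse.\<close>

definition covector_coords ::
  "('a, 'e::euclidean_space, 'm) manifold_data_scheme \<Rightarrow> ('a, 'e) chart \<Rightarrow> 'a
   \<Rightarrow> (('a, 'e) tangent \<Rightarrow> real) \<Rightarrow> 'e" where
  "covector_coords M c p \<beta> = (\<Sum>b\<in>Basis. \<beta> (coordinate_vector M p c b) *\<^sub>R b)"

definition covector_of_coords ::
  "('a, 'e::euclidean_space, 'm) manifold_data_scheme \<Rightarrow> ('a, 'e) chart \<Rightarrow> 'a \<Rightarrow> 'e
   \<Rightarrow> ('a, 'e) tangent \<Rightarrow> real" where
  "covector_of_coords M c p y = (\<lambda>v. if v \<in> tangent_space M p then y \<bullet> v c else 0)"

text \<open>Taking the component in \<open>c\<close> is a linear isomorphism from the tangent space to the model space;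
  transported along it, \<open>\<beta>\<close> is a linear functional, hence an inner product with the vector of its
  values on the basis.\<close>

lemma covector_eq_inner:
  assumes M: "smooth_manifold M" and c: "c \<in> charts_at M p"
    and \<beta>: "\<beta> \<in> cotangent_space M p" and v: "v \<in> tangent_space M p"
  shows "\<beta> v = covector_coords M c p \<beta> \<bullet> v c"
proof -
  let ?L = "\<lambda>x. \<beta> (coordinate_vector M p c x)"
  have comb: "?L (s *\<^sub>R x + t *\<^sub>R y) = s * ?L x + t * ?L y" for s t x y
    using \<beta> coordinate_vector_in_tangent_space[OF M c]
    by (simp add: coordinate_vector_combination[OF M c] cotangent_space_def)
  have lin: "linear ?L"
  proof (rule linearI)
    show "?L (x + y) = ?L x + ?L y" for x y using comb[of 1 x 1 y] by simp
    show "?L (r *\<^sub>R x) = r *\<^sub>R ?L x" for r x using comb[of r x 0 x] by simp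
  qed
  have "?L (\<Sum>b\<in>Basis. (v c \<bullet> b) *\<^sub>R b) = (\<Sum>b\<in>Basis. ?L ((v c \<bullet> b) *\<^sub>R b))"
    by (rule linear_sum[OF lin])
  also have "\<dots> = (\<Sum>b\<in>Basis. (v c \<bullet> b) * ?L b)"
    using linear_scale[OF lin] by simp
  finally have "?L (v c) = (\<Sum>b\<in>Basis. (v c \<bullet> b) * ?L b)" by (simp add: euclidean_representation)
  also have "\<dots> = covector_coords M c p \<beta> \<bullet> v c"
    unfolding covector_coords_def inner_sum_left
    by (rule sum.cong) (simp_all add: inner_commute mult.commute)
  finally show ?thesis by (simp add: coordinate_vector_of_component[OF v c])
qed

lemma covector_of_coords_in_cotangent_space:
  assumes "smooth_manifold M" "c \<in> charts_at M p"
  shows "covector_of_coords M c p y \<in> cotangent_space M p"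
  using tangent_space_combination[OF assms]
  by (auto simp: cotangent_space_def covector_of_coords_def inner_add_right)

lemma covector_coords_of_coords:
  assumes "smooth_manifold M" "c \<in> charts_at M p"
  shows "covector_coords M c p (covector_of_coords M c p y) = y"
  unfolding covector_coords_def covector_of_coords_def
  by (simp add: coordinate_vector_in_tangent_space[OF assms] coordinate_vector_component[OF assms]
      euclidean_representation)

lemma covector_of_covector_coords:
  assumes "smooth_manifold M" "c \<in> charts_at M p" "\<beta> \<in> cotangent_space M p"
  shows "covector_of_coords M c p (covector_coords M c p \<beta>) = \<beta>"
proof
  fix v
  show "covector_of_coords M c p (covector_coords M c p \<beta>) v = \<beta> v"
    using covector_eq_inner[OF assms] assms(3)
    by (cases "v \<in> tangent_space M p") (auto simp: covector_of_coords_def cotangent_space_def)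
qed

section \<open>The topology of the cotangent bundle\<close>

lemma fst_cotangent_chart:
  "fst (cotangent_chart M c) = {(p, \<beta>). p \<in> fst c \<and> \<beta> \<in> cotangent_space M p}"
  by (simp add: cotangent_chart_def)

lemma snd_cotangent_chart:
  "snd (cotangent_chart M c) (p, \<beta>) = (snd c p, covector_coords M c p \<beta>)"
  by (simp add: cotangent_chart_def covector_coords_def)

lemma inj_on_cotangent_chart:
  assumes M: "smooth_manifold M" and c: "c \<in> charts M"
  shows "inj_on (snd (cotangent_chart M c)) (fst (cotangent_chart M c))"
proof (rule inj_onI)
  fix z w assume zw: "z \<in> fst (cotangent_chart M c)" "w \<in> fst (cotangent_chart M c)"
    and eq: "snd (cotangent_chart M c) z = snd (cotangent_chart M c) w"
  obtain p \<beta> q \<gamma> where z: "z = (p, \<beta>)" and w: "w = (q, \<gamma>)" by (meson surj_pair)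
  have pq: "p \<in> fst c" "\<beta> \<in> cotangent_space M p" "q \<in> fst c" "\<gamma> \<in> cotangent_space M q"
    using zw by (auto simp: z w fst_cotangent_chart)
  have pq': "p = q" using eq pq inj_on_charts[OF M c] by (auto simp: z w snd_cotangent_chart inj_on_def)
  have cp: "c \<in> charts_at M p" using c pq by (simp add: charts_at_def)
  have "\<beta> = covector_of_coords M c p (covector_coords M c p \<beta>)"
    by (rule covector_of_covector_coords[OF M cp pq(2), symmetric])
  also have "covector_coords M c p \<beta> = covector_coords M c p \<gamma>"
    using eq by (simp add: z w snd_cotangent_chart pq')
  also have "covector_of_coords M c p \<dots> = \<gamma>"
    by (rule covector_of_covector_coords[OF M cp]) (use pq pq' in simp)
  finally show "z = w" by (simp add: z w pq')
qed

lemma cotangent_chart_overlap: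
  assumes M: "smooth_manifold M" and c: "c \<in> charts M"
  shows "snd (cotangent_chart M c) ` (fst (cotangent_chart M c) \<inter> fst (cotangent_chart M d)) =
    snd c ` (fst c \<inter> fst d) \<times> UNIV"
proof (intro equalityI subsetI)
  fix x assume "x \<in> snd c ` (fst c \<inter> fst d) \<times> (UNIV :: 'b set)"
  then obtain p y where x: "x = (snd c p, y)" and p: "p \<in> fst c" "p \<in> fst d" by auto
  have cp: "c \<in> charts_at M p" using c p by (simp add: charts_at_def)
  let ?z = "(p, covector_of_coords M c p y)"
  have "x = snd (cotangent_chart M c) ?z"
    by (simp add: x snd_cotangent_chart covector_coords_of_coords[OF M cp])
  then show "x \<in> snd (cotangent_chart M c) `
      (fst (cotangent_chart M c) \<inter> fst (cotangent_chart M d))"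
  proof (rule image_eqI)
    show "?z \<in> fst (cotangent_chart M c) \<inter> fst (cotangent_chart M d)"
      using p covector_of_coords_in_cotangent_space[OF M cp] by (simp add: fst_cotangent_chart)
  qed
next
  fix x assume "x \<in> snd (cotangent_chart M c) `
      (fst (cotangent_chart M c) \<inter> fst (cotangent_chart M d))"
  then obtain w where w: "x = snd (cotangent_chart M c) w"
      "w \<in> fst (cotangent_chart M c)" "w \<in> fst (cotangent_chart M d)" by blast
  obtain p \<beta> where p: "w = (p, \<beta>)" by (cases w)
  have "x = (snd c p, covector_coords M c p \<beta>)" "p \<in> fst c" "p \<in> fst d"
    using w by (simp_all add: p fst_cotangent_chart snd_cotangent_chart)
  then show "x \<in> snd c ` (fst c \<inter> fst d) \<times> UNIV" by simp
qed

text \<open>A change of charts acts on covector coordinates by the transposed inverse Jacobian; the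
  continuity of the Jacobian makes the induced change of cotangent charts continuous.\<close>

lemma covector_coords_transition:
  assumes M: "smooth_manifold M" and c: "c \<in> charts_at M p" and d: "d \<in> charts_at M p"
    and \<beta>: "\<beta> \<in> cotangent_space M p"
  shows "covector_coords M d p \<beta> = (\<Sum>b\<in>Basis. (covector_coords M c p \<beta> \<bullet>
    frechet_derivative (snd c \<circ> chart_inv d) (at (snd d p)) b) *\<^sub>R b)"
proof -
  have comp: "coordinate_vector M p d b c =
      frechet_derivative (snd c \<circ> chart_inv d) (at (snd d p)) b" for b
    using c by (simp add: coordinate_vector_def)
  show ?thesis
    unfolding covector_coords_def[of M d]
    by (rule sum.cong)
       (simp_all only: covector_eq_inner[OF M c \<beta> coordinate_vector_in_tangent_space[OF M d]] comp)
qed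

lemma continuous_on_cotangent_transition:
  assumes M: "smooth_manifold M" and c: "c \<in> charts M" and d: "d \<in> charts M"
  shows "continuous_on
    (snd (cotangent_chart M c) ` (fst (cotangent_chart M c) \<inter> fst (cotangent_chart M d)))
    (snd (cotangent_chart M d) \<circ> chart_inv (cotangent_chart M c))"
proof -
  let ?S = "snd c ` (fst c \<inter> fst d)" and ?T = "snd d ` (fst d \<inter> fst c)"
  let ?\<psi> = "snd d \<circ> chart_inv c"
  let ?J = "\<lambda>x b. frechet_derivative (snd c \<circ> chart_inv d) (at x) b"
  have \<psi>: "continuous_on ?S ?\<psi>"
    by (rule smooth_on_imp_continuous_on[OF smooth_transition[OF M c d]])
  have J: "continuous_on ?T (\<lambda>x. ?J x b)" for b
    by (rule smooth_on_imp_continuous_on_derivative[OF smooth_transition[OF M d c]])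
  have inv: "chart_inv c (snd c p) = p" if "p \<in> fst c" for p
    by (rule chart_inv_image[OF inj_on_charts[OF M c] that])
  have "continuous_on (?S \<times> UNIV) (\<lambda>z. ?\<psi> (fst z))"
    by (rule continuous_on_compose2[OF \<psi> continuous_on_fst[OF continuous_on_id]]) auto
  then have "continuous_on (?S \<times> UNIV) (\<lambda>z. ?J (?\<psi> (fst z)) b)" for b
    by (rule continuous_on_compose2[OF J]) (use inv in auto)
  with \<open>continuous_on (?S \<times> UNIV) (\<lambda>z. ?\<psi> (fst z))\<close>
  have "continuous_on (?S \<times> UNIV)
      (\<lambda>z. (?\<psi> (fst z), \<Sum>b\<in>Basis. (snd z \<bullet> ?J (?\<psi> (fst z)) b) *\<^sub>R b))"
    by (intro continuous_on_Pair continuous_on_sum continuous_on_scaleR continuous_on_inner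
        continuous_on_snd continuous_on_id continuous_on_const)
  moreover have "(snd (cotangent_chart M d) \<circ> chart_inv (cotangent_chart M c)) z =
      (?\<psi> (fst z), \<Sum>b\<in>Basis. (snd z \<bullet> ?J (?\<psi> (fst z)) b) *\<^sub>R b)" if z: "z \<in> ?S \<times> UNIV" for z
  proof -
    obtain w where w: "w \<in> fst (cotangent_chart M c) \<inter> fst (cotangent_chart M d)"
        "z = snd (cotangent_chart M c) w"
      using z unfolding cotangent_chart_overlap[OF M c, of d, symmetric] by blast
    obtain p \<beta> where p: "w = (p, \<beta>)" by (cases w)
    have "chart_inv (cotangent_chart M c) z = w"
      using w chart_inv_image[OF inj_on_cotangent_chart[OF M c]] by blast
    moreover have "p \<in> fst c" "p \<in> fst d" "\<beta> \<in> cotangent_space M p"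
      using w by (auto simp: p fst_cotangent_chart)
    ultimately show ?thesis
      using covector_coords_transition[OF M, of c p d \<beta>] c d
      by (simp add: w(2) p snd_cotangent_chart inv charts_at_def)
  qed
  ultimately show ?thesis
    unfolding cotangent_chart_overlap[OF M c] by (simp cong: continuous_on_cong)
qed

lemma charts_cotangent_bundleE:
  assumes "c' \<in> charts (cotangent_bundle M)"
  obtains c where "c \<in> charts M" "c' = cotangent_chart M c"
  using assms by (auto simp: cotangent_bundle_def)

lemma cotangent_chart_in_charts:
  "c \<in> charts M \<Longrightarrow> cotangent_chart M c \<in> charts (cotangent_bundle M)"
  by (simp add: cotangent_bundle_def)

lemma fst_cotangent_chart_subset:
  assumes "smooth_manifold M" "c \<in> charts M"
  shows "fst (cotangent_chart M c) \<subseteq> points (cotangent_bundle M)"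
proof -
  have "fst c \<subseteq> points M" using assms unfolding smooth_manifold_def by blast
  then show ?thesis by (auto simp: cotangent_bundle_def fst_cotangent_chart)
qed

lemma inj_on_charts_cotangent_bundle:
  assumes M: "smooth_manifold M" and c': "c' \<in> charts (cotangent_bundle M)"
  shows "inj_on (snd c') (fst c')"
proof -
  obtain c where "c \<in> charts M" "c' = cotangent_chart M c"
    by (rule charts_cotangent_bundleE[OF c'])
  then show ?thesis using inj_on_cotangent_chart[OF M] by blast
qed

lemma cotangent_bundle_continuous_atlas:
  assumes M: "smooth_manifold M"
    and "c' \<in> charts (cotangent_bundle M)" "d' \<in> charts (cotangent_bundle M)"
  shows "open (snd c' ` (fst c' \<inter> fst d'))"
    and "continuous_on (snd c' ` (fst c' \<inter> fst d')) (snd d' \<circ> chart_inv c')"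
proof -
  obtain c where c: "c \<in> charts M" "c' = cotangent_chart M c"
    by (rule charts_cotangent_bundleE[OF assms(2)])
  obtain d where d: "d \<in> charts M" "d' = cotangent_chart M d"
    by (rule charts_cotangent_bundleE[OF assms(3)])
  show "open (snd c' ` (fst c' \<inter> fst d'))"
    using open_chart_overlap[OF M c(1) d(1)]
    by (simp add: c(2) d(2) cotangent_chart_overlap[OF M c(1)] open_Times)
  show "continuous_on (snd c' ` (fst c' \<inter> fst d')) (snd d' \<circ> chart_inv c')"
    unfolding c(2) d(2) by (rule continuous_on_cotangent_transition[OF M c(1) d(1)])
qed

lemma openin_cotangent_bundle:
  assumes M: "smooth_manifold M" and c: "c \<in> charts M"
    and V: "V \<subseteq> fst (cotangent_chart M c)" "open (snd (cotangent_chart M c) ` V)"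
  shows "openin (mtop (cotangent_bundle M)) V"
  by (rule openin_mtop_chart_subset[OF inj_on_charts_cotangent_bundle[OF M]
        cotangent_bundle_continuous_atlas[OF M] cotangent_chart_in_charts[OF c] V(1)
        order_trans[OF V(1) fst_cotangent_chart_subset[OF M c]] V(2)])

lemma homeomorphic_map_cotangent_chart:
  assumes M: "smooth_manifold M" and c: "c \<in> charts M" and A: "A \<subseteq> fst (cotangent_chart M c)"
  shows "homeomorphic_map (subtopology (mtop (cotangent_bundle M)) A)
    (top_of_set (snd (cotangent_chart M c) ` A)) (snd (cotangent_chart M c))"
  by (rule homeomorphic_map_chart[OF inj_on_charts_cotangent_bundle[OF M]
        cotangent_bundle_continuous_atlas[OF M] cotangent_chart_in_charts[OF c]
        fst_cotangent_chart_subset[OF M c] A])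

section \<open>Charts of the symplectization\<close>

text \<open>Covectors vanishing on the hyperplane are multiples of the local defining form \<open>a\<close>, which
  therefore trivializes the symplectization up to sign: the covectors
  \<open>e\<^sup>s a\<close> form one of the two components of its restriction to \<open>W\<close>. The logarithmic fibre
  coordinate \<open>s\<close> turns rescaling into a translation.\<close>

definition scaled_form ::
  "('a, 'e::euclidean_space) contact_data \<Rightarrow> ('a, 'e) chart \<Rightarrow> ('e \<Rightarrow> 'e) \<Rightarrow> real \<Rightarrow> 'a
   \<Rightarrow> ('a, 'e) covector" where
  "scaled_form Q c a s p = (p, covector_of_coords Q c p (exp s *\<^sub>R a (snd c p)))"

text \<open>The logarithmic chart expressed in a cotangent chart: \<open>(x, e\<^sup>s a(x)) \<mapsto> (x, s)\<close>, extended to all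
  \<open>y\<close> by taking the component of \<open>y\<close> along \<open>a(x)\<close>.\<close>

definition log_scale :: "('e::euclidean_space \<Rightarrow> 'e) \<Rightarrow> 'e \<times> 'e \<Rightarrow> 'e \<times> real" where
  "log_scale a = (\<lambda>z. (fst z, ln (snd z \<bullet> a (fst z) / (a (fst z) \<bullet> a (fst z)))))"

definition log_chart ::
  "('a, 'e::euclidean_space) contact_data \<Rightarrow> ('a, 'e) chart \<Rightarrow> 'a set \<Rightarrow> ('e \<Rightarrow> 'e)
   \<Rightarrow> (('a, 'e) covector, 'e \<times> real) chart" where
  "log_chart Q c W a =
     ({scaled_form Q c a s p | s p. p \<in> W}, log_scale a \<circ> snd (cotangent_chart Q c))"

lemma fst_log_chart: "fst (log_chart Q c W a) = {scaled_form Q c a s p | s p. p \<in> W}"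
  by (simp add: log_chart_def)

lemma local_defining_formD:
  assumes "local_defining_form Q c W a"
  shows "c \<in> charts Q" "openin (mtop Q) W" "W \<subseteq> fst c" "smooth_on (snd c ` W) a"
    and "\<And>p. p \<in> W \<Longrightarrow> c \<in> charts_at Q p"
    and "\<And>p. p \<in> W \<Longrightarrow> a (snd c p) \<noteq> 0"
    and "\<And>p. p \<in> W \<Longrightarrow> hyperplane Q p = {v \<in> tangent_space Q p. a (snd c p) \<bullet> v c = 0}"
  using assms unfolding local_defining_form_def charts_at_def by blast+

lemma local_defining_form_open_image:
  assumes M: "smooth_manifold Q" and L: "local_defining_form Q c W a"
  shows "open (snd c ` W)"
proof -
  note D = local_defining_formD[OF L]
  have "open (snd c ` (W \<inter> fst c))"
    using D(1,2) openin_mtop[OF inj_on_charts[OF M]] by blast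
  then show ?thesis using D(3) by (simp add: Int_absorb2)
qed

lemma local_defining_form_uminus:
  assumes M: "smooth_manifold Q" and L: "local_defining_form Q c W a"
  shows "local_defining_form Q c W (\<lambda>x. - a x)"
proof -
  note D = local_defining_formD[OF L]
  have "ck_on k (snd c ` W) (\<lambda>x. (-1) *\<^sub>R a x)" for k
    by (rule ck_on_scaleR[OF local_defining_form_open_image[OF M L]])
       (use D(4) in \<open>simp add: smooth_on_def\<close>)
  then have "smooth_on (snd c ` W) (\<lambda>x. - a x)" by (simp add: smooth_on_def)
  then show ?thesis using D(1-3,6,7) by (simp add: local_defining_form_def)
qed

lemma cotangent_chart_scaled_form:
  assumes "smooth_manifold Q" "c \<in> charts_at Q p"
  shows "snd (cotangent_chart Q c) (scaled_form Q c a s p) = (snd c p, exp s *\<^sub>R a (snd c p))"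
  by (simp add: scaled_form_def snd_cotangent_chart covector_coords_of_coords[OF assms])

lemma log_scale_exp: "a x \<noteq> 0 \<Longrightarrow> log_scale a (x, exp s *\<^sub>R a x) = (x, s)"
  by (simp add: log_scale_def)

lemma snd_log_chart:
  assumes M: "smooth_manifold Q" and L: "local_defining_form Q c W a" and p: "p \<in> W"
  shows "snd (log_chart Q c W a) (scaled_form Q c a s p) = (snd c p, s)"
  using local_defining_formD(5,6)[OF L p]
  by (simp add: log_chart_def cotangent_chart_scaled_form[OF M] log_scale_exp)

lemma inj_on_log_chart:
  assumes M: "smooth_manifold Q" and L: "local_defining_form Q c W a"
  shows "inj_on (snd (log_chart Q c W a)) (fst (log_chart Q c W a))"
proof (rule inj_onI)
  fix z w assume "z \<in> fst (log_chart Q c W a)" "w \<in> fst (log_chart Q c W a)"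
    and eq: "snd (log_chart Q c W a) z = snd (log_chart Q c W a) w"
  then obtain s p t q where z: "z = scaled_form Q c a s p" "p \<in> W"
    and w: "w = scaled_form Q c a t q" "q \<in> W" by (auto simp: fst_log_chart)
  have "(snd c p, s) = (snd c q, t)"
    using eq unfolding z(1) w(1) snd_log_chart[OF M L z(2)] snd_log_chart[OF M L w(2)] .
  moreover have "inj_on (snd c) W"
    using inj_on_charts[OF M] local_defining_formD(1,3)[OF L] inj_on_subset by blast
  ultimately have "p = q" "s = t" using z(2) w(2) by (auto dest: inj_onD)
  then show "z = w" using z w by simp
qed

lemma log_chart_image:
  assumes M: "smooth_manifold Q" and L: "local_defining_form Q c W a"
  shows "snd (log_chart Q c W a) ` fst (log_chart Q c W a) = snd c ` W \<times> UNIV"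
proof (intro equalityI subsetI)
  fix x assume "x \<in> snd (log_chart Q c W a) ` fst (log_chart Q c W a)"
  then obtain s p where "p \<in> W" "x = snd (log_chart Q c W a) (scaled_form Q c a s p)"
    by (auto simp: fst_log_chart)
  then show "x \<in> snd c ` W \<times> UNIV" by (simp add: snd_log_chart[OF M L])
next
  fix x assume "x \<in> snd c ` W \<times> (UNIV :: real set)"
  then obtain s p where "p \<in> W" "x = (snd c p, s)" by auto
  then have "x = snd (log_chart Q c W a) (scaled_form Q c a s p)"
      "scaled_form Q c a s p \<in> fst (log_chart Q c W a)"
    by (auto simp: snd_log_chart[OF M L] fst_log_chart)
  then show "x \<in> snd (log_chart Q c W a) ` fst (log_chart Q c W a)" by (rule image_eqI)
qed

lemma chart_inv_log_chart:
  assumes M: "smooth_manifold Q" and L: "local_defining_form Q c W a" and p: "p \<in> W"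
  shows "chart_inv (log_chart Q c W a) (snd c p, s) = scaled_form Q c a s p"
proof -
  have "scaled_form Q c a s p \<in> fst (log_chart Q c W a)" using p by (auto simp: fst_log_chart)
  from chart_inv_image[OF inj_on_log_chart[OF M L] this] show ?thesis
    by (simp only: snd_log_chart[OF M L p])
qed

lemma points_symplectization:
  "points (symplectization Q) =
     {(p, \<beta>). p \<in> points Q \<and> \<beta> \<in> cotangent_space Q p \<and> \<beta> \<noteq> (\<lambda>_. 0) \<and> (\<forall>v\<in>hyperplane Q p. \<beta> v = 0)}"
  by (auto simp: symplectization_def embedded_submanifold_def cotangent_bundle_def)

lemma scaled_form_in_symplectization:
  assumes M: "smooth_manifold Q" and L: "local_defining_form Q c W a" and p: "p \<in> W"
  shows "scaled_form Q c a s p \<in> points (symplectization Q)"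
proof -
  let ?\<beta> = "covector_of_coords Q c p (exp s *\<^sub>R a (snd c p))"
  let ?v = "coordinate_vector Q p c (a (snd c p))"
  note D = local_defining_formD[OF L]
  have "p \<in> points Q" using D(1,3) p M unfolding smooth_manifold_def by blast
  moreover have "?\<beta> ?v \<noteq> 0"
    using D(6)[OF p] coordinate_vector_in_tangent_space[OF M D(5)[OF p]]
      coordinate_vector_component[OF M D(5)[OF p]]
    by (simp add: covector_of_coords_def)
  then have "?\<beta> \<noteq> (\<lambda>_. 0)" by metis
  moreover have "?\<beta> v = 0" if "v \<in> hyperplane Q p" for v
    using that unfolding D(7)[OF p] by (simp add: covector_of_coords_def)
  ultimately show ?thesis
    using covector_of_coords_in_cotangent_space[OF M D(5)[OF p]]
    by (simp add: points_symplectization scaled_form_def)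
qed

lemma fst_log_chart_subset:
  assumes "smooth_manifold Q" "local_defining_form Q c W a"
  shows "fst (log_chart Q c W a) \<subseteq> points (symplectization Q)"
  using scaled_form_in_symplectization[OF assms] by (auto simp: fst_log_chart)

text \<open>The annihilator of a hyperplane is a line: the component of the coordinate vector of \<open>\<beta>\<close>
  orthogonal to \<open>a\<close> represents a tangent vector in the hyperplane, on which \<open>\<beta>\<close> takes its squared
  norm as value.\<close>

lemma annihilator_is_multiple:
  assumes M: "smooth_manifold Q" and L: "local_defining_form Q c W a" and p: "p \<in> W"
    and \<beta>: "\<beta> \<in> cotangent_space Q p" "\<And>v. v \<in> hyperplane Q p \<Longrightarrow> \<beta> v = 0"
  obtains t where "covector_coords Q c p \<beta> = t *\<^sub>R a (snd c p)"
proof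
  note D = local_defining_formD[OF L]
  define x where "x = a (snd c p)"
  define y where "y = covector_coords Q c p \<beta>"
  define t where "t = y \<bullet> x / (x \<bullet> x)"
  define w where "w = y - t *\<^sub>R x"
  have "x \<noteq> 0" using D(6)[OF p] by (simp add: x_def)
  then have xw: "x \<bullet> w = 0" by (simp add: w_def t_def inner_diff_right inner_commute)
  let ?v = "coordinate_vector Q p c w"
  have v: "?v \<in> tangent_space Q p" "?v c = w"
    using coordinate_vector_in_tangent_space[OF M D(5)[OF p]]
      coordinate_vector_component[OF M D(5)[OF p]] by blast+
  have "?v \<in> hyperplane Q p" unfolding D(7)[OF p] using v xw by (simp add: x_def)
  then have "y \<bullet> w = 0"
    using covector_eq_inner[OF M D(5)[OF p] \<beta>(1) v(1)] \<beta>(2) v(2) by (simp add: y_def)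
  then have "w \<bullet> w = 0" using xw by (simp add: w_def inner_diff_left inner_commute)
  then show "covector_coords Q c p \<beta> = t *\<^sub>R a (snd c p)"
    by (simp add: w_def flip: x_def y_def)
qed

text \<open>The annihilator being a line, the sign of the multiple is the sign of an inner product; in this
  form, membership in the chart domain is visibly an open condition.\<close>

lemma symplectization_positive_iff:
  assumes M: "smooth_manifold Q" and L: "local_defining_form Q c W a"
    and z: "(p, \<beta>) \<in> points (symplectization Q)"
  shows "(p, \<beta>) \<in> fst (log_chart Q c W a) \<longleftrightarrow>
    p \<in> W \<and> covector_coords Q c p \<beta> \<bullet> a (snd c p) > 0"
proof
  note D = local_defining_formD[OF L]
  assume "(p, \<beta>) \<in> fst (log_chart Q c W a)"
  then obtain s where p: "p \<in> W" and b: "\<beta> = covector_of_coords Q c p (exp s *\<^sub>R a (snd c p))"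
    by (auto simp: fst_log_chart scaled_form_def)
  then show "p \<in> W \<and> covector_coords Q c p \<beta> \<bullet> a (snd c p) > 0"
    using D(6)[OF p] by (simp add: covector_coords_of_coords[OF M D(5)[OF p]])
next
  note D = local_defining_formD[OF L]
  assume *: "p \<in> W \<and> covector_coords Q c p \<beta> \<bullet> a (snd c p) > 0"
  have \<beta>: "\<beta> \<in> cotangent_space Q p" "\<And>v. v \<in> hyperplane Q p \<Longrightarrow> \<beta> v = 0"
    using z by (auto simp: points_symplectization)
  obtain t where t: "covector_coords Q c p \<beta> = t *\<^sub>R a (snd c p)"
    using annihilator_is_multiple[OF M L _ \<beta>] * by blast
  have "t > 0" using * inner_ge_zero[of "a (snd c p)"] by (auto simp: t zero_less_mult_iff)
  have "\<beta> = covector_of_coords Q c p (t *\<^sub>R a (snd c p))"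
    using covector_of_covector_coords[OF M D(5) \<beta>(1)] * by (simp add: t)
  then have "(p, \<beta>) = scaled_form Q c a (ln t) p" using \<open>t > 0\<close> by (simp add: scaled_form_def)
  then show "(p, \<beta>) \<in> fst (log_chart Q c W a)" using * by (auto simp: fst_log_chart)
qed

text \<open>After changing the sign of the local defining form if necessary, every point lies in the
  domain of a logarithmic chart.\<close>

lemma symplectization_covered:
  assumes M: "smooth_manifold Q" and H: "hyperplane_distribution Q"
    and z: "z \<in> points (symplectization Q)"
  obtains c W a where "local_defining_form Q c W a" "z \<in> fst (log_chart Q c W a)"
proof -
  obtain p \<beta> where zp: "z = (p, \<beta>)" by (cases z)
  have p: "p \<in> points Q" and nz: "\<beta> \<noteq> (\<lambda>_. 0)"
    and \<beta>: "\<beta> \<in> cotangent_space Q p" "\<And>v. v \<in> hyperplane Q p \<Longrightarrow> \<beta> v = 0"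
    using z by (auto simp: zp points_symplectization)
  obtain c W a where W: "p \<in> W" and L: "local_defining_form Q c W a"
    using H p unfolding hyperplane_distribution_def by blast
  note D = local_defining_formD[OF L]
  obtain t where t: "covector_coords Q c p \<beta> = t *\<^sub>R a (snd c p)"
    using annihilator_is_multiple[OF M L W \<beta>] by blast
  have "t \<noteq> 0"
  proof
    assume "t = 0"
    then have "\<beta> = covector_of_coords Q c p 0"
      using covector_of_covector_coords[OF M D(5)[OF W] \<beta>(1)] by (simp add: t)
    also have "\<dots> = (\<lambda>_. 0)" unfolding covector_of_coords_def by (rule ext) (simp split: if_split)
    finally show False using nz by contradiction
  qed
  have L': "local_defining_form Q c W (\<lambda>x. - a x)" by (rule local_defining_form_uminus[OF M L])
  have a0: "a (snd c p) \<bullet> a (snd c p) > 0" using D(6)[OF W] by simp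
  show thesis
  proof (cases "t > 0")
    case True
    then have "z \<in> fst (log_chart Q c W a)"
      using z W a0 unfolding zp by (subst symplectization_positive_iff[OF M L]) (simp_all add: t)
    with L show thesis by (rule that)
  next
    case False
    then have "z \<in> fst (log_chart Q c W (\<lambda>x. - a x))"
      using z W a0 \<open>t \<noteq> 0\<close> unfolding zp
      by (subst symplectization_positive_iff[OF M L']) (simp_all add: t mult_neg_pos)
    with L' show thesis by (rule that)
  qed
qed

lemma inj_on_charts_embedded_submanifold:
  assumes "d \<in> charts (embedded_submanifold M S)"
  shows "inj_on (snd d) (fst d)"
proof -
  have dom: "openin (subtopology (mtop M) S) (fst d)"
    and hom: "homeomorphic_map (subtopology (mtop M) (fst d)) (top_of_set (snd d ` fst d)) (snd d)"
    using assms by (simp_all add: embedded_submanifold_def)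
  have "topspace (subtopology (mtop M) (fst d)) = fst d" using openin_subset[OF dom] by auto
  then show ?thesis using homeomorphic_imp_injective_map[OF hom] by simp
qed

text \<open>All charts of an embedded submanifold are homeomorphisms for the subspace topology, so they map
  its open sets to open sets.\<close>

lemma openin_mtop_embedded_submanifold:
  assumes A: "openin (subtopology (mtop M) S) A"
  shows "openin (mtop (embedded_submanifold M S :: ('a, 'f::euclidean_space) manifold_data)) A"
proof -
  let ?N = "embedded_submanifold M S :: ('a, 'f) manifold_data"
  have chart: "inj_on (snd d) (fst d) \<and> open (snd d ` (A \<inter> fst d))" if d: "d \<in> charts ?N" for d
  proof -
    have dom: "openin (subtopology (mtop M) S) (fst d)" and op: "open (snd d ` fst d)"
      and hom: "homeomorphic_map (subtopology (mtop M) (fst d)) (top_of_set (snd d ` fst d)) (snd d)"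
      using d by (simp_all add: embedded_submanifold_def)
    have sub: "fst d \<subseteq> S" using openin_subset[OF dom] by auto
    have inj: "inj_on (snd d) (fst d)" by (rule inj_on_charts_embedded_submanifold[OF d])
    obtain T where T: "openin (mtop M) T" "A = T \<inter> S"
      using A unfolding openin_subtopology by blast
    have "A \<inter> fst d = T \<inter> fst d" using T sub by blast
    then have "openin (subtopology (mtop M) (fst d)) (A \<inter> fst d)"
      using T(1) unfolding openin_subtopology by blast
    then have "openin (top_of_set (snd d ` fst d)) (snd d ` (A \<inter> fst d))"
      using homeomorphic_imp_open_map[OF hom] unfolding open_map_def by blast
    then show ?thesis using inj openin_open_trans op by blast
  qed
  have "A \<subseteq> points ?N" using openin_subset[OF A] by (auto simp: embedded_submanifold_def)
  then show ?thesis using chart by (simp add: openin_mtop)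
qed

lemma continuous_on_inner_form:
  fixes a :: "'e::euclidean_space \<Rightarrow> 'e"
  assumes "continuous_on S a"
  shows "continuous_on (S \<times> UNIV) (\<lambda>z. snd z \<bullet> a (fst z))"
    and "continuous_on (S \<times> (UNIV :: 'b::topological_space set)) (\<lambda>z. a (fst z))"
proof -
  show *: "continuous_on (S \<times> (UNIV :: 'b::topological_space set)) (\<lambda>z. a (fst z))"
    by (rule continuous_on_compose2[OF assms continuous_on_fst[OF continuous_on_id]]) auto
  have "continuous_on (S \<times> (UNIV :: 'e set)) (\<lambda>z. a (fst z))"
    by (rule continuous_on_compose2[OF assms continuous_on_fst[OF continuous_on_id]]) auto
  then show "continuous_on (S \<times> UNIV) (\<lambda>z. snd z \<bullet> a (fst z))"
    by (intro continuous_on_inner continuous_on_snd continuous_on_id)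
qed

lemma fst_log_chart_subset_cotangent:
  assumes M: "smooth_manifold Q" and L: "local_defining_form Q c W a"
  shows "fst (log_chart Q c W a) \<subseteq> fst (cotangent_chart Q c)"
proof
  note D = local_defining_formD[OF L]
  fix z assume "z \<in> fst (log_chart Q c W a)"
  then obtain s p where p: "p \<in> W" "z = scaled_form Q c a s p" by (auto simp: fst_log_chart)
  then show "z \<in> fst (cotangent_chart Q c)"
    using D(3) covector_of_coords_in_cotangent_space[OF M D(5)[OF p(1)]]
    by (auto simp: fst_cotangent_chart scaled_form_def)
qed

lemma openin_symplectization_log_chart:
  fixes Q :: "('a, 'b::euclidean_space) contact_data"
  assumes M: "smooth_manifold Q" and L: "local_defining_form Q c W a"
  shows "openin (subtopology (mtop (cotangent_bundle Q)) (points (symplectization Q)))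
    (fst (log_chart Q c W a))"
proof -
  note D = local_defining_formD[OF L]
  let ?C = "cotangent_chart Q c"
  \<comment> \<open>the open half of the cotangent bundle over \<open>W\<close> cut out by positivity on \<open>a\<close>\<close>
  let ?U = "(snd c ` W \<times> UNIV) \<inter> (\<lambda>z. snd z \<bullet> a (fst z)) -` {0<..}"
  let ?O = "{z \<in> fst ?C. snd ?C z \<in> ?U}"
  have "open ?U"
    by (rule continuous_open_preimage[OF continuous_on_inner_form(1)[OF smooth_on_imp_continuous_on[OF D(4)]]])
       (simp_all add: open_Times local_defining_form_open_image[OF M L])
  moreover have "snd ?C ` ?O = ?U"
  proof -
    have "snd c ` W \<subseteq> snd c ` (fst c \<inter> fst c)" using D(3) by auto
    then have "?U \<subseteq> snd ?C ` (fst ?C \<inter> fst ?C)"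
      unfolding cotangent_chart_overlap[OF M D(1)] by blast
    then have "?U \<subseteq> snd ?C ` fst ?C" by simp
    moreover have "f ` {z \<in> A. f z \<in> U} = U" if "U \<subseteq> f ` A"
      for f :: "('a, 'b) covector \<Rightarrow> 'b \<times> 'b" and A U using that by blast
    ultimately show ?thesis by (simp only:)
  qed
  ultimately have "open (snd ?C ` ?O)" by (simp only:)
  then have "openin (mtop (cotangent_bundle Q)) ?O"
    by (rule openin_cotangent_bundle[OF M D(1) Collect_restrict])
  moreover have "fst (log_chart Q c W a) = ?O \<inter> points (symplectization Q)"
  proof (rule set_eqI)
    fix z :: "('a, 'b) covector"
    obtain p \<beta> where z: "z = (p, \<beta>)" by (cases z)
    have W: "snd c p \<in> snd c ` W \<longleftrightarrow> p \<in> W" if "p \<in> fst c"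
      using that D(3) inj_on_charts[OF M D(1)] by (auto simp: inj_on_def)
    show "z \<in> fst (log_chart Q c W a) \<longleftrightarrow> z \<in> ?O \<inter> points (symplectization Q)"
    proof (cases "z \<in> points (symplectization Q) \<and> z \<in> fst ?C")
      case True
      then have "p \<in> fst c" by (simp add: z fst_cotangent_chart)
      then show ?thesis using True W symplectization_positive_iff[OF M L, of p \<beta>]
        by (simp add: z snd_cotangent_chart)
    next
      case False
      then show ?thesis
        using fst_log_chart_subset[OF M L] fst_log_chart_subset_cotangent[OF M L] by blast
    qed
  qed
  ultimately show ?thesis unfolding openin_subtopology by blast
qed

text \<open>A logarithmic chart is a cotangent chart followed by \<^const>\<open>log_scale\<close>; the latter is a
  homeomorphism on the relevant set, with inverse \<open>(x, s) \<mapsto> (x, e\<^sup>s a(x))\<close>.\<close>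

lemma homeomorphic_map_log_chart:
  assumes M: "smooth_manifold Q" and L: "local_defining_form Q c W a"
  shows "homeomorphic_map (subtopology (mtop (cotangent_bundle Q)) (fst (log_chart Q c W a)))
    (top_of_set (snd c ` W \<times> UNIV)) (snd (log_chart Q c W a))"
proof -
  note D = local_defining_formD[OF L]
  let ?A = "fst (log_chart Q c W a)"
  let ?B = "snd (cotangent_chart Q c) ` ?A"
  let ?R = "snd c ` W \<times> (UNIV :: real set)"
  let ?g = "\<lambda>z. (fst z, exp (snd z) *\<^sub>R a (fst z))"
  note ca = smooth_on_imp_continuous_on[OF D(4)]
  have lse: "log_scale a (snd c p, exp s *\<^sub>R a (snd c p)) = (snd c p, s)" if "p \<in> W" for p s
    using log_scale_exp[where a = a and x = "snd c p"] D(6)[OF that] by blast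
  have B: "\<exists>p s. p \<in> W \<and> z = (snd c p, exp s *\<^sub>R a (snd c p))" if z: "z \<in> ?B" for z
  proof -
    obtain w where w: "w \<in> ?A" "z = snd (cotangent_chart Q c) w" using z by blast
    then obtain s p where "p \<in> W" "w = scaled_form Q c a s p" by (auto simp: fst_log_chart)
    with w(2) show ?thesis using cotangent_chart_scaled_form[OF M D(5)] by blast
  qed
  have BI: "(snd c p, exp s *\<^sub>R a (snd c p)) \<in> ?B" if "p \<in> W" for p s
  proof (rule image_eqI)
    show "scaled_form Q c a s p \<in> ?A" using that by (auto simp: fst_log_chart)
  qed (simp add: cotangent_chart_scaled_form[OF M D(5)[OF that]])
  have sub: "?B \<subseteq> snd c ` W \<times> UNIV" using B by fastforce
  have "homeomorphic_maps (top_of_set ?B) (top_of_set ?R) (log_scale a) ?g"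
    unfolding homeomorphic_maps_def
  proof (intro conjI ballI)
    have pos: "snd z \<bullet> a (fst z) > 0 \<and> a (fst z) \<bullet> a (fst z) > 0" if "z \<in> ?B" for z
      using B[OF that] D(6) by auto
    have "continuous_on ?B (log_scale a)"
      unfolding log_scale_def
    proof (intro continuous_on_Pair continuous_on_ln continuous_on_divide continuous_on_inner
        continuous_on_fst continuous_on_snd continuous_on_id ballI)
      show "continuous_on ?B (\<lambda>z. a (fst z))" "continuous_on ?B (\<lambda>z. a (fst z))"
        "continuous_on ?B (\<lambda>z. a (fst z))"
        by (rule continuous_on_subset[OF continuous_on_inner_form(2)[OF ca] sub])+
      fix z assume "z \<in> ?B"
      with pos show "a (fst z) \<bullet> a (fst z) \<noteq> 0"
        "snd z \<bullet> a (fst z) / (a (fst z) \<bullet> a (fst z)) \<noteq> 0" by fastforce+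
    qed
    moreover have "log_scale a \<in> ?B \<rightarrow> ?R"
    proof
      fix z assume "z \<in> ?B"
      then obtain p s where "p \<in> W" "z = (snd c p, exp s *\<^sub>R a (snd c p))" using B by blast
      then show "log_scale a z \<in> ?R" using lse[OF \<open>p \<in> W\<close>, of s] by simp
    qed
    ultimately show "continuous_map (top_of_set ?B) (top_of_set ?R) (log_scale a)"
      by (simp add: continuous_map_in_subtopology image_subset_iff_funcset)
    have "continuous_on ?R ?g"
      by (intro continuous_on_Pair continuous_on_scaleR continuous_on_exp continuous_on_inner_form(2)
          continuous_on_fst continuous_on_snd continuous_on_id ca)
    moreover have "?g \<in> ?R \<rightarrow> ?B" using BI by auto
    ultimately show "continuous_map (top_of_set ?R) (top_of_set ?B) ?g"
      by (simp add: continuous_map_in_subtopology image_subset_iff_funcset)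
  next
    fix z assume "z \<in> topspace (top_of_set ?B)"
    then have "z \<in> ?B" by (simp only: topspace_euclidean_subtopology)
    then obtain p s where "p \<in> W" "z = (snd c p, exp s *\<^sub>R a (snd c p))" using B by blast
    then show "?g (log_scale a z) = z" using lse[OF \<open>p \<in> W\<close>, of s] by simp
  next
    fix z assume "z \<in> topspace (top_of_set ?R)"
    then obtain p s where "p \<in> W" "z = (snd c p, s)" by auto
    then show "log_scale a (?g z) = z" using lse[OF \<open>p \<in> W\<close>, of s] by simp
  qed
  then have "homeomorphic_map (top_of_set ?B) (top_of_set ?R) (log_scale a)"
    using homeomorphic_map_maps by blast
  from homeomorphic_map_compose[OF homeomorphic_map_cotangent_chart[OF M D(1)
        fst_log_chart_subset_cotangent[OF M L]] this]
  show ?thesis by (simp add: log_chart_def)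
qed

text \<open>In the charts of the cotangent bundle, the inverse of a logarithmic chart is
  \<open>(x, s) \<mapsto> (x, e\<^sup>s a(x))\<close>; it is immersive because \<open>a\<close> has no zeros.\<close>

lemma immersive_log_chart_inv:
  assumes M: "smooth_manifold Q" and L: "local_defining_form Q c W a" and x: "x \<in> snd c ` W \<times> UNIV"
  shows "immersive_at (open_region (snd c ` W \<times> UNIV)) (cotangent_bundle Q)
    (chart_inv (log_chart Q c W a)) x"
proof -
  note D = local_defining_formD[OF L]
  let ?R = "snd c ` W \<times> (UNIV :: real set)"
  let ?f = "chart_inv (log_chart Q c W a)"
  let ?a' = "frechet_derivative a (at (fst x))"
  let ?g = "\<lambda>z. (fst z, exp (snd z) *\<^sub>R a (fst z))"
  let ?g' = "\<lambda>v. (fst v, exp (snd x) *\<^sub>R (?a' (fst v) + snd v *\<^sub>R a (fst x)))"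
  have oW: "open (snd c ` W)" by (rule local_defining_form_open_image[OF M L])
  then have oR: "open ?R" by (simp add: open_Times)
  have f: "?f z \<in> fst (cotangent_chart Q c) \<and> snd (cotangent_chart Q c) (?f z) = ?g z"
    if "z \<in> ?R" for z
  proof -
    obtain p s where p: "p \<in> W" "z = (snd c p, s)" using \<open>z \<in> ?R\<close> by auto
    then have "scaled_form Q c a s p \<in> fst (log_chart Q c W a)" by (auto simp: fst_log_chart)
    then show ?thesis
      using fst_log_chart_subset_cotangent[OF M L] cotangent_chart_scaled_form[OF M D(5)[OF p(1)]]
      by (auto simp: p(2) chart_inv_log_chart[OF M L p(1)])
  qed
  show ?thesis
  proof (rule smooth_at_with_coordinatesI[where c = "(?R, id)" and d = "cotangent_chart Q c"
        and W = ?R and g = ?g and g' = ?g'])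
    show "(?R, id) \<in> charts_at (open_region ?R) x"
      using x by (simp add: charts_at_def open_region_def)
    show "cotangent_chart Q c \<in> charts_at (cotangent_bundle Q) (?f x)"
      using f[OF x] cotangent_chart_in_charts[OF D(1)] by (simp add: charts_at_def)
    show "openin (mtop (open_region ?R)) ?R" by (simp add: openin_open_region oR)
    show "?f ` ?R \<subseteq> fst (cotangent_chart Q c)" using f by blast
    show "snd (cotangent_chart Q c) (?f q) = ?g (snd (?R, id) q)" if "q \<in> ?R" for q
      using f[OF that] by simp
    have "ck_on k ?R fst" for k by (rule ck_on_bounded_linear[OF bounded_linear_fst])
    then have "ck_on k ?R ?g" for k
      using D(4) by (intro ck_on_Pair[OF oR] ck_on_exp_scale[OF oW]) (simp_all add: smooth_on_def)
    then show "smooth_on (snd (?R, id) ` ?R) ?g" by (simp add: smooth_on_def)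
    have "(a has_derivative ?a') (at (fst x))"
      by (rule smooth_on_has_derivative[OF D(4)]) (use x in auto)
    then have "(?g has_derivative ?g') (at x)"
      by (intro has_derivative_Pair has_derivative_fst[OF has_derivative_ident] has_derivative_exp_scale)
    then show "(?g has_derivative ?g') (at (snd (?R, id) x))" by simp
    have "a (fst x) \<noteq> 0" using x D(6) by auto
    then show "inj ?g'" by (intro injI) (auto intro: prod_eqI)
  qed (use x oR in auto)
qed

lemma log_chart_in_charts:
  assumes M: "smooth_manifold Q" and L: "local_defining_form Q c W a"
  shows "log_chart Q c W a \<in> charts (symplectization Q)"
proof -
  have S: "symplectization Q = embedded_submanifold (cotangent_bundle Q) (points (symplectization Q))"
    by (simp add: symplectization_def embedded_submanifold_def)
  have "open (snd c ` W \<times> (UNIV :: real set))"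
    using local_defining_form_open_image[OF M L] by (simp add: open_Times)
  then have "log_chart Q c W a \<in>
      charts (embedded_submanifold (cotangent_bundle Q) (points (symplectization Q)))"
    unfolding embedded_submanifold_def
    using openin_symplectization_log_chart[OF M L] homeomorphic_map_log_chart[OF M L]
      immersive_log_chart_inv[OF M L]
    by (simp only: manifold_data.simps mem_Collect_eq log_chart_image[OF M L]) blast
  then show ?thesis using S by metis
qed

lemma openin_log_chart:
  assumes M: "smooth_manifold Q" and L: "local_defining_form Q c W a"
  shows "openin (mtop (symplectization Q)) (fst (log_chart Q c W a))"
proof -
  have S: "symplectization Q = embedded_submanifold (cotangent_bundle Q) (points (symplectization Q))"
    by (simp add: symplectization_def embedded_submanifold_def)
  show ?thesis
    by (subst S) (rule openin_mtop_embedded_submanifold[OF openin_symplectization_log_chart[OF M L]])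
qed


section \<open>Charts of the contact product\<close>

lemma inj_on_charts_symplectization:
  "d \<in> charts (symplectization Q) \<Longrightarrow> inj_on (snd d) (fst d)"
  unfolding symplectization_def by (rule inj_on_charts_embedded_submanifold)

lemma inj_on_charts_product_manifold:
  assumes "\<And>c. c \<in> charts M \<Longrightarrow> inj_on (snd c) (fst c)"
    and "\<And>d. d \<in> charts N \<Longrightarrow> inj_on (snd d) (fst d)"
    and "e \<in> charts (product_manifold M N)"
  shows "inj_on (snd e) (fst e)"
  using assms by (auto simp: product_manifold_def intro!: map_prod_inj_on)

lemma openin_mtop_product_manifold:
  assumes M: "\<And>c. c \<in> charts M \<Longrightarrow> inj_on (snd c) (fst c)"
    and N: "\<And>d. d \<in> charts N \<Longrightarrow> inj_on (snd d) (fst d)"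
    and A: "openin (mtop M) A" and B: "openin (mtop N) B"
  shows "openin (mtop (product_manifold M N)) (A \<times> B)"
proof -
  have A': "A \<subseteq> points M" "\<And>c. c \<in> charts M \<Longrightarrow> open (snd c ` (A \<inter> fst c))"
    and B': "B \<subseteq> points N" "\<And>d. d \<in> charts N \<Longrightarrow> open (snd d ` (B \<inter> fst d))"
    using A B openin_mtop[OF M] openin_mtop[OF N] by blast+
  have "open (snd e ` ((A \<times> B) \<inter> fst e))" if e_in: "e \<in> charts (product_manifold M N)" for e
  proof -
    obtain c d where c: "c \<in> charts M" and d: "d \<in> charts N"
      and e: "e = (fst c \<times> fst d, map_prod (snd c) (snd d))"
      using e_in unfolding product_manifold_def by auto
    have "snd e ` ((A \<times> B) \<inter> fst e) = (snd c ` (A \<inter> fst c)) \<times> (snd d ` (B \<inter> fst d))"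
      by (simp add: e Times_Int_Times map_prod_surj_on)
    then show ?thesis using A'(2)[OF c] B'(2)[OF d] by (simp add: open_Times)
  qed
  moreover have "A \<times> B \<subseteq> points (product_manifold M N)"
    using A'(1) B'(1) by (auto simp: product_manifold_def)
  ultimately show ?thesis
    by (simp only: openin_mtop[OF inj_on_charts_product_manifold[OF M N]]) blast
qed

lemma rescale_rescale: "rescale r (rescale s z) = rescale (r * s) z"
  by (simp add: rescale_def split_beta mult.assoc)

lemma rescale_1: "rescale 1 z = z"
  by (simp add: rescale_def split_beta)

lemma fst_rescale: "fst (rescale r z) = fst z"
  by (simp add: rescale_def split_beta)

lemma in_orbit_map: "z \<in> orbit_map z"
proof -
  have "z = (rescale 1 (fst z), rescale 1 (snd z))" by (simp add: rescale_1)
  then show ?thesis unfolding orbit_map_def using zero_less_one by blast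
qed

lemma orbit_map_rescale:
  assumes "r > 0"
  shows "orbit_map (rescale r z, rescale r w) = orbit_map (z, w)"
proof (intro equalityI subsetI)
  fix u assume "u \<in> orbit_map (rescale r z, rescale r w)"
  then obtain s where "s > 0" "u = (rescale (s * r) z, rescale (s * r) w)"
    by (auto simp: orbit_map_def rescale_rescale)
  moreover have "s * r > 0" using \<open>s > 0\<close> assms by simp
  ultimately show "u \<in> orbit_map (z, w)" unfolding orbit_map_def by auto
next
  fix u assume "u \<in> orbit_map (z, w)"
  then obtain s where s: "s > 0" "u = (rescale s z, rescale s w)" by (auto simp: orbit_map_def)
  then have "u = (rescale (s / r) (rescale r z), rescale (s / r) (rescale r w))"
    using assms by (simp add: rescale_rescale)
  moreover have "s / r > 0" using s assms by simp
  ultimately show "u \<in> orbit_map (rescale r z, rescale r w)" unfolding orbit_map_def by auto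
qed

lemma rescale_scaled_form:
  assumes "r > 0"
  shows "rescale r (scaled_form Q c a s p) = scaled_form Q c a (s + ln r) p"
  using assms
  by (auto simp: rescale_def scaled_form_def covector_of_coords_def exp_add mult.commute mult.left_commute)

lemma rescale_in_log_chart:
  assumes "r > 0" "z \<in> fst (log_chart Q c W a)"
  shows "rescale r z \<in> fst (log_chart Q c W a)"
proof -
  obtain s p where "p \<in> W" "z = scaled_form Q c a s p" using assms(2) by (auto simp: fst_log_chart)
  then have "rescale r z = scaled_form Q c a (s + ln r) p" by (simp add: rescale_scaled_form assms(1))
  then show ?thesis unfolding fst_log_chart using \<open>p \<in> W\<close> by blast
qed

lemma snd_log_chart_rescale:
  assumes "smooth_manifold Q" "local_defining_form Q c W a" "z \<in> fst (log_chart Q c W a)" "r > 0"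
  shows "snd (log_chart Q c W a) (rescale r z) = snd (log_chart Q c W a) z + (0, ln r)"
proof -
  obtain s p where "p \<in> W" "z = scaled_form Q c a s p" using assms(3) by (auto simp: fst_log_chart)
  then show ?thesis using assms(4) by (simp add: rescale_scaled_form snd_log_chart[OF assms(1,2)])
qed

text \<open>In logarithmic coordinates, the diagonal action translates both fibre coordinates by the same
  amount, so that their difference is the remaining coordinate on the quotient.\<close>

definition log_ratio :: "('e \<times> real) \<times> ('f \<times> real) \<Rightarrow> 'e \<times> 'f \<times> real" where
  "log_ratio u = (fst (fst u), fst (snd u), snd (snd u) - snd (fst u))"

lemma bounded_linear_log_ratio:
  "bounded_linear (log_ratio :: ('e::euclidean_space \<times> real) \<times> ('f::euclidean_space \<times> real) \<Rightarrow> _)"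
proof -
  have "linear (log_ratio :: ('e \<times> real) \<times> ('f \<times> real) \<Rightarrow> _)"
    by (rule linearI) (simp_all add: log_ratio_def algebra_simps)
  then show ?thesis by (simp add: linear_conv_bounded_linear)
qed

lemma log_ratio_eqD:
  fixes u v :: "('e::real_vector \<times> real) \<times> ('f::real_vector \<times> real)"
  assumes "log_ratio u = log_ratio v"
  shows "v = u + ((0, snd (fst v) - snd (fst u)), (0, snd (fst v) - snd (fst u)))"
  using assms by (auto simp: log_ratio_def prod_eq_iff)

text \<open>A pair of local defining forms yields a chart of the product of the symplectizations, on the
  pairs of positive multiples, and a chart of the contact product, on their orbits. The quotient map
  is \<^const>\<open>log_ratio\<close> in these charts.\<close>

locale local_forms =
  fixes Q0 :: "('a, 'e::euclidean_space) contact_data"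
    and Q1 :: "('b, 'f::euclidean_space) contact_data"
    and c0 :: "('a, 'e) chart" and W0 :: "'a set" and a0 :: "'e \<Rightarrow> 'e"
    and c1 :: "('b, 'f) chart" and W1 :: "'b set" and a1 :: "'f \<Rightarrow> 'f"
  assumes M0: "smooth_manifold Q0" and L0: "local_defining_form Q0 c0 W0 a0"
    and M1: "smooth_manifold Q1" and L1: "local_defining_form Q1 c1 W1 a1"
begin

abbreviation "P \<equiv> symplectization_product Q0 Q1"

definition positive_pairs :: "(('a, 'e) covector \<times> ('b, 'f) covector) set" where
  "positive_pairs = fst (log_chart Q0 c0 W0 a0) \<times> fst (log_chart Q1 c1 W1 a1)"

definition pair_coords :: "('a, 'e) covector \<times> ('b, 'f) covector \<Rightarrow> ('e \<times> real) \<times> ('f \<times> real)" where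
  "pair_coords = map_prod (snd (log_chart Q0 c0 W0 a0)) (snd (log_chart Q1 c1 W1 a1))"

definition orbit_chart ::
  "((('a, 'e) covector \<times> ('b, 'f) covector) set, 'e \<times> 'f \<times> real) chart" where
  "orbit_chart = (orbit_map ` positive_pairs, \<lambda>y. log_ratio (pair_coords (SOME z. z \<in> y)))"

lemma inj_on_charts_P: "e \<in> charts P \<Longrightarrow> inj_on (snd e) (fst e)"
  unfolding symplectization_product_def
  by (rule inj_on_charts_product_manifold[OF inj_on_charts_symplectization inj_on_charts_symplectization])

lemma pair_chart_in_charts: "(positive_pairs, pair_coords) \<in> charts P"
  unfolding symplectization_product_def product_manifold_def positive_pairs_def pair_coords_def
    manifold_data.simps mem_Collect_eq
  using log_chart_in_charts[OF M0 L0] log_chart_in_charts[OF M1 L1] by blast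

lemma openin_positive_pairs: "openin (mtop P) positive_pairs"
  unfolding symplectization_product_def positive_pairs_def
  by (rule openin_mtop_product_manifold[OF inj_on_charts_symplectization inj_on_charts_symplectization
        openin_log_chart[OF M0 L0] openin_log_chart[OF M1 L1]])

lemma positive_pairs_subset: "positive_pairs \<subseteq> points P"
  using fst_log_chart_subset[OF M0 L0] fst_log_chart_subset[OF M1 L1]
  by (auto simp: symplectization_product_def product_manifold_def positive_pairs_def)

lemma pair_coords_image: "pair_coords ` positive_pairs = (snd c0 ` W0 \<times> UNIV) \<times> (snd c1 ` W1 \<times> UNIV)"
  by (simp add: pair_coords_def positive_pairs_def map_prod_surj_on
      log_chart_image[OF M0 L0] log_chart_image[OF M1 L1])

lemma open_pair_coords_image: "open (pair_coords ` positive_pairs)"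
  by (simp add: pair_coords_image open_Times local_defining_form_open_image[OF M0 L0]
      local_defining_form_open_image[OF M1 L1])

lemma positive_pairs_rescale:
  "r > 0 \<Longrightarrow> z \<in> positive_pairs \<Longrightarrow> (rescale r (fst z), rescale r (snd z)) \<in> positive_pairs"
  by (auto simp: positive_pairs_def rescale_in_log_chart)

lemma pair_coords_rescale:
  assumes "r > 0" "z \<in> positive_pairs"
  shows "pair_coords (rescale r (fst z), rescale r (snd z)) = pair_coords z + ((0, ln r), (0, ln r))"
proof -
  obtain u v where z: "z = (u, v)" by (cases z)
  then show ?thesis
    using assms snd_log_chart_rescale[OF M0 L0 _ assms(1)] snd_log_chart_rescale[OF M1 L1 _ assms(1)]
    by (simp add: pair_coords_def positive_pairs_def)
qed

lemma orbit_map_eqE: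
  assumes "orbit_map z = orbit_map w"
  obtains r where "r > 0" "z = (rescale r (fst w), rescale r (snd w))"
  using assms in_orbit_map[of z] unfolding orbit_map_def by blast

text \<open>Positive multiples are preserved by the action; the domain of the orbit chart therefore has an
  open preimage.\<close>

lemma positive_pairs_saturated:
  assumes "orbit_map z \<in> fst orbit_chart"
  shows "z \<in> positive_pairs"
proof -
  obtain w where w: "w \<in> positive_pairs" "orbit_map z = orbit_map w"
    using assms by (auto simp: orbit_chart_def)
  obtain r where "r > 0" "z = (rescale r (fst w), rescale r (snd w))"
    by (rule orbit_map_eqE[OF w(2)])
  then show ?thesis using positive_pairs_rescale w(1) by blast
qed

lemma orbit_chart_orbit_map:
  assumes z: "z \<in> positive_pairs"
  shows "snd orbit_chart (orbit_map z) = log_ratio (pair_coords z)"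
proof -
  have "(SOME w. w \<in> orbit_map z) \<in> orbit_map z" using in_orbit_map by (rule someI)
  then obtain r where r: "r > 0"
      "(SOME w. w \<in> orbit_map z) = (rescale r (fst z), rescale r (snd z))"
    unfolding orbit_map_def by blast
  show ?thesis
    unfolding orbit_chart_def snd_conv r(2) pair_coords_rescale[OF r(1) z]
    by (simp add: log_ratio_def)
qed

lemma orbit_chart_image: "snd orbit_chart ` fst orbit_chart = snd c0 ` W0 \<times> snd c1 ` W1 \<times> UNIV"
proof -
  have "snd orbit_chart ` fst orbit_chart = (\<lambda>z. snd orbit_chart (orbit_map z)) ` positive_pairs"
    by (simp add: orbit_chart_def image_image)
  also have "\<dots> = (\<lambda>z. log_ratio (pair_coords z)) ` positive_pairs"
    by (rule image_cong[OF refl orbit_chart_orbit_map])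
  also have "\<dots> = log_ratio ` ((snd c0 ` W0 \<times> UNIV) \<times> (snd c1 ` W1 \<times> UNIV))"
    by (simp only: pair_coords_image flip: image_image)
  also have "\<dots> = snd c0 ` W0 \<times> snd c1 ` W1 \<times> UNIV"
  proof (intro equalityI subsetI)
    fix x :: "'e \<times> 'f \<times> real" assume x: "x \<in> snd c0 ` W0 \<times> snd c1 ` W1 \<times> UNIV"
    show "x \<in> log_ratio ` ((snd c0 ` W0 \<times> UNIV) \<times> (snd c1 ` W1 \<times> UNIV))"
      by (rule image_eqI[of _ _ "((fst x, 0), (fst (snd x), snd (snd x)))"])
         (use x in \<open>auto simp: log_ratio_def\<close>)
  qed (auto simp: log_ratio_def)
  finally show ?thesis .
qed

lemma open_orbit_chart_image: "open (snd orbit_chart ` fst orbit_chart)"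
  by (simp add: orbit_chart_image open_Times local_defining_form_open_image[OF M0 L0]
      local_defining_form_open_image[OF M1 L1])

text \<open>Two pairs with the same value of \<^const>\<open>log_ratio\<close> differ by a common translation by \<open>t\<close> of
  their fibre coordinates, hence by the action of \<open>e\<^sup>t\<close>.\<close>

lemma inj_on_orbit_chart: "inj_on (snd orbit_chart) (fst orbit_chart)"
proof (rule inj_onI)
  fix y y' assume "y \<in> fst orbit_chart" "y' \<in> fst orbit_chart"
    and eq: "snd orbit_chart y = snd orbit_chart y'"
  then obtain z w where z: "z \<in> positive_pairs" "y = orbit_map z"
    and w: "w \<in> positive_pairs" "y' = orbit_map w" by (auto simp: orbit_chart_def)
  have "log_ratio (pair_coords z) = log_ratio (pair_coords w)"
    using eq unfolding z(2) w(2) by (simp only: orbit_chart_orbit_map z(1) w(1))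
  then obtain t where t: "pair_coords w = pair_coords z + ((0, t), (0, t))"
    using log_ratio_eqD by blast
  let ?z = "(rescale (exp t) (fst z), rescale (exp t) (snd z))"
  have "pair_coords ?z = pair_coords w"
    using pair_coords_rescale[OF exp_gt_zero z(1)] t by simp
  moreover have "?z \<in> positive_pairs" by (rule positive_pairs_rescale[OF exp_gt_zero z(1)])
  ultimately have "?z = w"
    using inj_on_charts_P[OF pair_chart_in_charts] w(1) by (auto dest: inj_onD)
  then show "y = y'" using orbit_map_rescale[OF exp_gt_zero, of t "fst z" "snd z"] z(2) w(2) by simp
qed

lemma preimage_orbit_chart: "{z \<in> points P. orbit_map z \<in> fst orbit_chart} = positive_pairs"
proof (intro equalityI subsetI)
  fix z assume "z \<in> positive_pairs"
  then show "z \<in> {z \<in> points P. orbit_map z \<in> fst orbit_chart}"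
    using positive_pairs_subset by (auto simp: orbit_chart_def)
qed (use positive_pairs_saturated in blast)

lemma submersive_orbit_chart:
  assumes z: "z \<in> positive_pairs"
  shows "submersive_at P (open_region UNIV) (snd orbit_chart \<circ> orbit_map) z"
proof (rule smooth_at_with_coordinatesI[where c = "(positive_pairs, pair_coords)"
      and d = "(UNIV, id)" and W = positive_pairs and g = log_ratio and g' = log_ratio])
  show "(positive_pairs, pair_coords) \<in> charts_at P z"
    using pair_chart_in_charts z by (simp add: charts_at_def)
  show "inj_on (snd (positive_pairs, pair_coords)) (fst (positive_pairs, pair_coords))"
    by (rule inj_on_charts_P[OF pair_chart_in_charts])
  show "snd (UNIV, id) ((snd orbit_chart \<circ> orbit_map) q) =
      log_ratio (snd (positive_pairs, pair_coords) q)" if "q \<in> positive_pairs" for q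
    using orbit_chart_orbit_map[OF that] by simp
  show "smooth_on (snd (positive_pairs, pair_coords) ` positive_pairs) log_ratio"
    by (rule smooth_on_bounded_linear[OF bounded_linear_log_ratio])
  show "(log_ratio has_derivative log_ratio) (at (snd (positive_pairs, pair_coords) z))"
    by (rule bounded_linear_imp_has_derivative[OF bounded_linear_log_ratio])
  show "surj (log_ratio :: ('e \<times> real) \<times> ('f \<times> real) \<Rightarrow> _)"
  proof (rule surjI)
    show "log_ratio ((fst x, 0), (fst (snd x), snd (snd x))) = x" for x :: "'e \<times> 'f \<times> real"
      by (simp add: log_ratio_def)
  qed
qed (use z openin_positive_pairs open_pair_coords_image in \<open>simp_all add: charts_at_def open_region_def\<close>)

lemma orbit_chart_in_charts: "orbit_chart \<in> charts (contact_product Q0 Q1)"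
proof -
  have "fst orbit_chart \<subseteq> orbit_map ` points P"
    using positive_pairs_subset by (auto simp: orbit_chart_def)
  moreover have "submersive_at P (open_region UNIV) (snd orbit_chart \<circ> orbit_map) z"
    if "z \<in> points P" "orbit_map z \<in> fst orbit_chart" for z
    using submersive_orbit_chart positive_pairs_saturated that by blast
  ultimately have "orbit_chart \<in> charts (quotient_manifold P orbit_map)"
    using inj_on_orbit_chart open_orbit_chart_image openin_positive_pairs
    unfolding quotient_manifold_def
    by (simp only: manifold_data.simps mem_Collect_eq preimage_orbit_chart) blast
  then show ?thesis by (simp add: contact_product_def Let_def)
qed

lemma openin_orbit_chart: "openin (mtop (contact_product Q0 Q1)) (fst orbit_chart)"
proof -
  have "openin (mtop (quotient_manifold P orbit_map ::
      ((('a, 'e) covector \<times> ('b, 'f) covector) set, 'e \<times> 'f \<times> real) manifold_data)) (fst orbit_chart)"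
  proof (rule openin_mtop_quotient)
    show "fst orbit_chart \<subseteq> orbit_map ` points P"
      using positive_pairs_subset by (auto simp: orbit_chart_def)
    show "openin (mtop P) {z \<in> points P. orbit_map z \<in> fst orbit_chart}"
      unfolding preimage_orbit_chart by (rule openin_positive_pairs)
  qed (rule inj_on_charts_P)
  then show ?thesis by (simp add: mtop_def contact_product_def Let_def)
qed

text \<open>The projections will be instances with \<open>l\<close> forgetting all coordinates but those of one factor.\<close>

lemma submersive_if_linear_in_orbit_chart:
  fixes N :: "('c, 'g::euclidean_space, 'm) manifold_data_scheme" and l :: "'e \<times> 'f \<times> real \<Rightarrow> 'g"
  assumes z: "z \<in> positive_pairs" and d: "d \<in> charts N"
    and f: "\<And>w. w \<in> positive_pairs \<Longrightarrow> f (orbit_map w) \<in> fst d"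
    and l: "\<And>w. w \<in> positive_pairs \<Longrightarrow> snd d (f (orbit_map w)) = l (log_ratio (pair_coords w))"
    and "bounded_linear l" "surj l"
  shows "submersive_at (contact_product Q0 Q1) N f (orbit_map z)"
proof (rule smooth_at_with_coordinatesI[where c = orbit_chart and d = d
      and W = "fst orbit_chart" and g = l and g' = l])
  show y: "orbit_map z \<in> fst orbit_chart" using z by (simp add: orbit_chart_def)
  show "orbit_chart \<in> charts_at (contact_product Q0 Q1) (orbit_map z)"
    using orbit_chart_in_charts y by (simp add: charts_at_def)
  show "d \<in> charts_at N (f (orbit_map z))" using d f[OF z] by (simp add: charts_at_def)
  show "f ` fst orbit_chart \<subseteq> fst d" using f by (auto simp: orbit_chart_def)
  show "snd d (f q) = l (snd orbit_chart q)" if q: "q \<in> fst orbit_chart" for q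
  proof -
    obtain w where "w \<in> positive_pairs" "q = orbit_map w" using q by (auto simp: orbit_chart_def)
    then show ?thesis by (simp add: l orbit_chart_orbit_map)
  qed
  show "smooth_on (snd orbit_chart ` fst orbit_chart) l"
    by (rule smooth_on_bounded_linear[OF assms(5)])
  show "(l has_derivative l) (at (snd orbit_chart (orbit_map z)))"
    by (rule bounded_linear_imp_has_derivative[OF assms(5)])
qed (use inj_on_orbit_chart openin_orbit_chart open_orbit_chart_image assms(6) in simp_all)

lemma log_chart_base_coordinate:
  assumes "smooth_manifold Q" "local_defining_form Q c W a" "u \<in> fst (log_chart Q c W a)"
  shows "fst u \<in> fst c" "snd c (fst u) = fst (snd (log_chart Q c W a) u)"
proof -
  obtain s p where p: "p \<in> W" "u = scaled_form Q c a s p" using assms(3) by (auto simp: fst_log_chart)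
  then show "fst u \<in> fst c" "snd c (fst u) = fst (snd (log_chart Q c W a) u)"
    using local_defining_formD(3)[OF assms(2)] snd_log_chart[OF assms(1,2) p(1)]
    by (auto simp: scaled_form_def)
qed

lemma submersive_projections:
  assumes z: "z \<in> positive_pairs"
    and p0: "\<And>w. w \<in> points P \<Longrightarrow> p0 (orbit_map w) = proj0 w"
    and p1: "\<And>w. w \<in> points P \<Longrightarrow> p1 (orbit_map w) = proj1 w"
  shows "submersive_at (contact_product Q0 Q1) Q0 p0 (orbit_map z)"
    and "submersive_at (contact_product Q0 Q1) Q1 p1 (orbit_map z)"
proof -
  have *: "p0 (orbit_map w) \<in> fst c0 \<and> snd c0 (p0 (orbit_map w)) = fst (log_ratio (pair_coords w))"
    "p1 (orbit_map w) \<in> fst c1 \<and> snd c1 (p1 (orbit_map w)) = fst (snd (log_ratio (pair_coords w)))"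
    if w: "w \<in> positive_pairs" for w
  proof -
    have "w \<in> points P" using w positive_pairs_subset by blast
    then have "p0 (orbit_map w) = fst (fst w)" "p1 (orbit_map w) = fst (snd w)"
      using p0 p1 by (simp_all add: proj0_def proj1_def bundle_projection_def)
    moreover have "fst w \<in> fst (log_chart Q0 c0 W0 a0)" "snd w \<in> fst (log_chart Q1 c1 W1 a1)"
      using w by (auto simp: positive_pairs_def)
    ultimately show
      "p0 (orbit_map w) \<in> fst c0 \<and> snd c0 (p0 (orbit_map w)) = fst (log_ratio (pair_coords w))"
      "p1 (orbit_map w) \<in> fst c1 \<and> snd c1 (p1 (orbit_map w)) = fst (snd (log_ratio (pair_coords w)))"
      using log_chart_base_coordinate[OF M0 L0] log_chart_base_coordinate[OF M1 L1]
      by (simp_all add: log_ratio_def pair_coords_def map_prod_def split_beta)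
  qed
  show "submersive_at (contact_product Q0 Q1) Q0 p0 (orbit_map z)"
    by (rule submersive_if_linear_in_orbit_chart[OF z local_defining_formD(1)[OF L0], where l = fst])
       (use * bounded_linear_fst in auto)
  have "surj (\<lambda>x :: 'e \<times> 'f \<times> real. fst (snd x))"
    by (rule surjI[of _ "\<lambda>y. (0, y, 0)"]) simp
  then show "submersive_at (contact_product Q0 Q1) Q1 p1 (orbit_map z)"
    by (intro submersive_if_linear_in_orbit_chart[OF z local_defining_formD(1)[OF L1],
          where l = "\<lambda>x. fst (snd x)"])
       (use * bounded_linear_compose[OF bounded_linear_fst bounded_linear_snd] in auto)
qed

end

section \<open>The projections of the contact product\<close>

lemma points_symplectization_product:
  "points (symplectization_product Q0 Q1) = points (symplectization Q0) \<times> points (symplectization Q1)"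
  by (simp add: symplectization_product_def product_manifold_def)

lemma points_contact_product:
  "points (contact_product Q0 Q1) = orbit_map ` points (symplectization_product Q0 Q1)"
  by (simp add: contact_product_def Let_def quotient_manifold_def)

lemma smooth_submersion_in_points:
  "smooth_submersion M N f \<Longrightarrow> p \<in> points M \<Longrightarrow> f p \<in> points N"
  by (simp add: smooth_submersion_def)

lemma symplectization_fibre_nonempty:
  assumes "contact_manifold Q" "q \<in> points Q"
  obtains z where "z \<in> points (symplectization Q)" "fst z = q"
proof -
  have M: "smooth_manifold Q" and H: "hyperplane_distribution Q"
    using assms(1) by (simp_all add: contact_manifold_def)
  obtain c W a where "q \<in> W" "local_defining_form Q c W a"
    using H assms(2) unfolding hyperplane_distribution_def by blast
  then have "scaled_form Q c a 0 q \<in> points (symplectization Q)"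
    by (intro scaled_form_in_symplectization[OF M])
  then show thesis by (rule that) (simp add: scaled_form_def)
qed

text \<open>The orbit chart used at a point of the contact product depends on the point, as the local
  defining forms have to be chosen with the right signs.\<close>

lemma submersion_of_orbit_invariant_projections:
  assumes Q0: "contact_manifold Q0" and Q1: "contact_manifold Q1"
    and p0: "\<And>w. w \<in> points (symplectization_product Q0 Q1) \<Longrightarrow> p0 (orbit_map w) = proj0 w"
    and p1: "\<And>w. w \<in> points (symplectization_product Q0 Q1) \<Longrightarrow> p1 (orbit_map w) = proj1 w"
  shows "smooth_submersion (contact_product Q0 Q1) Q0 p0"
    and "smooth_submersion (contact_product Q0 Q1) Q1 p1"
proof -
  have M0: "smooth_manifold Q0" and H0: "hyperplane_distribution Q0"
    and M1: "smooth_manifold Q1" and H1: "hyperplane_distribution Q1"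
    using Q0 Q1 by (simp_all add: contact_manifold_def)
  have both: "p0 y \<in> points Q0 \<and> submersive_at (contact_product Q0 Q1) Q0 p0 y \<and>
      p1 y \<in> points Q1 \<and> submersive_at (contact_product Q0 Q1) Q1 p1 y"
    if y: "y \<in> points (contact_product Q0 Q1)" for y
  proof -
    obtain z where z: "z \<in> points (symplectization_product Q0 Q1)" "y = orbit_map z"
      using y unfolding points_contact_product by blast
    have z': "fst z \<in> points (symplectization Q0)" "snd z \<in> points (symplectization Q1)"
      using z(1) by (auto simp: points_symplectization_product)
    obtain c0 W0 a0 where F0: "local_defining_form Q0 c0 W0 a0" "fst z \<in> fst (log_chart Q0 c0 W0 a0)"
      by (rule symplectization_covered[OF M0 H0 z'(1)])
    obtain c1 W1 a1 where F1: "local_defining_form Q1 c1 W1 a1" "snd z \<in> fst (log_chart Q1 c1 W1 a1)"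
      by (rule symplectization_covered[OF M1 H1 z'(2)])
    interpret local_forms Q0 Q1 c0 W0 a0 c1 W1 a1
      by unfold_locales (fact M0 F0(1) M1 F1(1))+
    have "z \<in> positive_pairs" using F0(2) F1(2) by (simp add: positive_pairs_def mem_Times_iff)
    moreover have "p0 y \<in> points Q0" "p1 y \<in> points Q1"
      using z z' p0 p1
      by (auto simp: proj0_def proj1_def bundle_projection_def points_symplectization)
    ultimately show ?thesis using submersive_projections[OF _ p0 p1] z(2) by blast
  qed
  show "smooth_submersion (contact_product Q0 Q1) Q0 p0"
    "smooth_submersion (contact_product Q0 Q1) Q1 p1"
    unfolding smooth_submersion_def by ((intro ballI, drule both, elim conjE, intro conjI; assumption)+)
qed

theorem proposition1p5:
  fixes Q0 :: "('a, 'e::euclidean_space) contact_data"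
    and Q1 :: "('b, 'f::euclidean_space) contact_data"
  assumes "contact_manifold Q0" and "contact_manifold Q1"
  shows "\<exists>p0 p1.
    smooth_submersion (contact_product Q0 Q1) Q0 p0 \<and>
    smooth_submersion (contact_product Q0 Q1) Q1 p1 \<and>
    (points Q1 \<noteq> {} \<longrightarrow> p0 ` points (contact_product Q0 Q1) = points Q0) \<and>
    (points Q0 \<noteq> {} \<longrightarrow> p1 ` points (contact_product Q0 Q1) = points Q1) \<and>
    (\<forall>z\<in>points (symplectization_product Q0 Q1). p0 (orbit_map z) = proj0 z) \<and>
    (\<forall>z\<in>points (symplectization_product Q0 Q1). p1 (orbit_map z) = proj1 z) \<and>
    (\<forall>q0. (\<forall>z\<in>points (symplectization_product Q0 Q1). q0 (orbit_map z) = proj0 z) \<longrightarrow>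
       (\<forall>y\<in>points (contact_product Q0 Q1). q0 y = p0 y)) \<and>
    (\<forall>q1. (\<forall>z\<in>points (symplectization_product Q0 Q1). q1 (orbit_map z) = proj1 z) \<longrightarrow>
       (\<forall>y\<in>points (contact_product Q0 Q1). q1 y = p1 y))"
proof -
  \<comment> \<open>The base points are constant along orbits, so any representative of an orbit may be chosen.\<close>
  define p0 where "p0 = (\<lambda>y :: (('a, 'e) covector \<times> ('b, 'f) covector) set. proj0 (SOME z. z \<in> y))"
  define p1 where "p1 = (\<lambda>y :: (('a, 'e) covector \<times> ('b, 'f) covector) set. proj1 (SOME z. z \<in> y))"
  have base: "fst (fst w) = fst (fst z) \<and> fst (snd w) = fst (snd z)" if w: "w \<in> orbit_map z"
    for w z :: "('a, 'e) covector \<times> ('b, 'f) covector"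
  proof -
    obtain r where "w = (rescale r (fst z), rescale r (snd z))"
      using w unfolding orbit_map_def by blast
    then show ?thesis by (simp only: fst_conv snd_conv fst_rescale)
  qed
  have some: "(SOME w. w \<in> orbit_map z) \<in> orbit_map z"
    for z :: "('a, 'e) covector \<times> ('b, 'f) covector"
    using in_orbit_map by (rule someI)
  have p0: "p0 (orbit_map z) = proj0 z" for z
    using base[OF some[of z]] by (simp only: p0_def proj0_def bundle_projection_def o_apply)
  have p1: "p1 (orbit_map z) = proj1 z" for z
    using base[OF some[of z]] by (simp only: p1_def proj1_def bundle_projection_def o_apply)
  note sub = submersion_of_orbit_invariant_projections[OF assms p0 p1]
  have img0: "p0 ` points (contact_product Q0 Q1) = points Q0" if ne: "points Q1 \<noteq> {}"
  proof (intro equalityI subsetI)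
    show "x \<in> points Q0" if "x \<in> p0 ` points (contact_product Q0 Q1)" for x
      using that smooth_submersion_in_points[OF sub(1)] by blast
    fix x assume "x \<in> points Q0"
    then obtain z where z: "z \<in> points (symplectization Q0)" "fst z = x"
      using symplectization_fibre_nonempty[OF assms(1)] by blast
    obtain w where w: "w \<in> points (symplectization Q1)"
      using ne symplectization_fibre_nonempty[OF assms(2)] by blast
    have "orbit_map (z, w) \<in> points (contact_product Q0 Q1)"
      using z w by (simp add: points_contact_product points_symplectization_product)
    moreover have "p0 (orbit_map (z, w)) = x"
      using z(2) by (simp add: p0 proj0_def bundle_projection_def)
    ultimately show "x \<in> p0 ` points (contact_product Q0 Q1)" by blast
  qed
  have img1: "p1 ` points (contact_product Q0 Q1) = points Q1" if ne: "points Q0 \<noteq> {}"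
  proof (intro equalityI subsetI)
    show "x \<in> points Q1" if "x \<in> p1 ` points (contact_product Q0 Q1)" for x
      using that smooth_submersion_in_points[OF sub(2)] by blast
    fix x assume "x \<in> points Q1"
    then obtain w where w: "w \<in> points (symplectization Q1)" "fst w = x"
      using symplectization_fibre_nonempty[OF assms(2)] by blast
    obtain z where z: "z \<in> points (symplectization Q0)"
      using ne symplectization_fibre_nonempty[OF assms(1)] by blast
    have "orbit_map (z, w) \<in> points (contact_product Q0 Q1)"
      using z w by (simp add: points_contact_product points_symplectization_product)
    moreover have "p1 (orbit_map (z, w)) = x"
      using w(2) by (simp add: p1 proj1_def bundle_projection_def)
    ultimately show "x \<in> p1 ` points (contact_product Q0 Q1)" by blast
  qed
  have unique0: "\<forall>q0. (\<forall>z\<in>points (symplectization_product Q0 Q1). q0 (orbit_map z) = proj0 z) \<longrightarrow>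
      (\<forall>y\<in>points (contact_product Q0 Q1). q0 y = p0 y)"
  proof (intro allI impI ballI)
    fix q0 y
    assume q: "\<forall>z\<in>points (symplectization_product Q0 Q1). q0 (orbit_map z) = proj0 z"
      and "y \<in> points (contact_product Q0 Q1)"
    then obtain z where z: "z \<in> points (symplectization_product Q0 Q1)" "y = orbit_map z"
      unfolding points_contact_product by blast
    show "q0 y = p0 y" unfolding z(2) p0 by (rule bspec[OF q z(1)])
  qed
  have unique1: "\<forall>q1. (\<forall>z\<in>points (symplectization_product Q0 Q1). q1 (orbit_map z) = proj1 z) \<longrightarrow>
      (\<forall>y\<in>points (contact_product Q0 Q1). q1 y = p1 y)"
  proof (intro allI impI ballI)
    fix q1 y
    assume q: "\<forall>z\<in>points (symplectization_product Q0 Q1). q1 (orbit_map z) = proj1 z"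
      and "y \<in> points (contact_product Q0 Q1)"
    then obtain z where z: "z \<in> points (symplectization_product Q0 Q1)" "y = orbit_map z"
      unfolding points_contact_product by blast
    show "q1 y = p1 y" unfolding z(2) p1 by (rule bspec[OF q z(1)])
  qed
  show ?thesis
  proof (intro exI[of _ p0] exI[of _ p1] conjI)
    show "smooth_submersion (contact_product Q0 Q1) Q0 p0" by (rule sub(1))
    show "smooth_submersion (contact_product Q0 Q1) Q1 p1" by (rule sub(2))
    show "points Q1 \<noteq> {} \<longrightarrow> p0 ` points (contact_product Q0 Q1) = points Q0"
      by (rule impI) (rule img0)
    show "points Q0 \<noteq> {} \<longrightarrow> p1 ` points (contact_product Q0 Q1) = points Q1"
      by (rule impI) (rule img1)
    show "\<forall>z\<in>points (symplectization_product Q0 Q1). p0 (orbit_map z) = proj0 z"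
      by (intro ballI p0)
    show "\<forall>z\<in>points (symplectization_product Q0 Q1). p1 (orbit_map z) = proj1 z"
      by (intro ballI p1)
  qed (rule unique0, rule unique1)
qed

end
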